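(* Let $S = R\cup B$ be a finite set of points in the plane in general position (no three collinear), colored red ($R$) and blue ($B$), with $R$ and $B$ linearly separable. Then $S$ has a balanced convex $4$-hole if and only if condition C1 or condition C2 holds.
   Context: A $4$-hole of $S$ is a simple quadrilateral with vertices in $S$ and no point of $S$ in its interior; it is convex if the quadrilateral is convex, and balanced if it has exactly two red and two blue vertices. $CH(X)$ is the convex hull of $X$; $\Delta xyz$ is the open triangle with vertices $x,y,z$; for non-collinear $a,b,c$, $\mathcal{W}(a,b,c)$ is the open convex region bounded by the rays from $a$ through $b$ and from $a$ through $c$. An edge $e$ of $CH(R)$ and an edge $e'$ of $CH(B)$ see each other if the union of their vertex sets is the vertex set of a balanced convex $4$-hole whose interior intersects neither $CH(R)$ nor $CH(B)$. Condition C1: there exist an edge $e$ of $CH(R)$ and an edge $e'$ of $CH(B)$ that see each other. Condition C2: there exist an edge $\overline{uv}$ of $CH(R)$ and points $b,z\in B$ with $z\in\Delta uvb$, $R\cap\Delta uvb=\emptyset$ and $R\cap\mathcal{W}(b,u,v)\ne\emptyset$; or the same statement holds with the roles of $R$ and $B$ swapped. *)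

theory Defs
  imports "HOL-Analysis.Analysis"
begin

type_synonym point = "real \<times> real"

definition general_position :: "point set \<Rightarrow> bool" where
  "general_position S \<longleftrightarrow>
     (\<forall>a\<in>S. \<forall>b\<in>S. \<forall>c\<in>S. a \<noteq> b \<and> a \<noteq> c \<and> b \<noteq> c \<longrightarrow> \<not> collinear {a, b, c})"

definition linearly_separable :: "point set \<Rightarrow> point set \<Rightarrow> bool" where
  "linearly_separable R B \<longleftrightarrow>
     (\<exists>w::point. \<exists>c::real. w \<noteq> 0 \<and> (\<forall>r\<in>R. w \<bullet> r < c) \<and> (\<forall>b\<in>B. w \<bullet> b > c))"

definition hull_edge :: "point set \<Rightarrow> point \<Rightarrow> point \<Rightarrow> bool" where
  "hull_edge X u v \<longleftrightarrow>
     u \<in> X \<and> v \<in> X \<and> u \<noteq> v \<and> closed_segment u v face_of convex hull X"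

definition convex_position :: "point set \<Rightarrow> bool" where
  "convex_position Q \<longleftrightarrow> (\<forall>q\<in>Q. q \<notin> convex hull (Q - {q}))"

definition balanced_convex_4hole :: "point set \<Rightarrow> point set \<Rightarrow> point set \<Rightarrow> bool" where
  "balanced_convex_4hole R B Q \<longleftrightarrow>
     Q \<subseteq> R \<union> B \<and> card Q = 4 \<and> convex_position Q \<and>
     card (Q \<inter> R) = 2 \<and> card (Q \<inter> B) = 2 \<and>
     (R \<union> B) \<inter> interior (convex hull Q) = {}"

definition open_triangle :: "point \<Rightarrow> point \<Rightarrow> point \<Rightarrow> point set" where
  "open_triangle x y z = interior (convex hull {x, y, z})"

definition wedge :: "point \<Rightarrow> point \<Rightarrow> point \<Rightarrow> point set" where
  "wedge a b c = {a + s *\<^sub>R (b - a) + t *\<^sub>R (c - a) | s t. s > 0 \<and> t > 0}"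

definition see_each_other :: "point set \<Rightarrow> point set \<Rightarrow> point \<Rightarrow> point \<Rightarrow> point \<Rightarrow> point \<Rightarrow> bool" where
  "see_each_other R B u v u' v' \<longleftrightarrow>
     hull_edge R u v \<and> hull_edge B u' v' \<and>
     balanced_convex_4hole R B {u, v, u', v'} \<and>
     interior (convex hull {u, v, u', v'}) \<inter> convex hull R = {} \<and>
     interior (convex hull {u, v, u', v'}) \<inter> convex hull B = {}"

definition cond_C1 :: "point set \<Rightarrow> point set \<Rightarrow> bool" where
  "cond_C1 R B \<longleftrightarrow> (\<exists>u v u' v'. see_each_other R B u v u' v')"

definition cond_C2_one :: "point set \<Rightarrow> point set \<Rightarrow> bool" where
  "cond_C2_one R B \<longleftrightarrow>
     (\<exists>u v b z. hull_edge R u v \<and> b \<in> B \<and> z \<in> B \<and>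
        z \<in> open_triangle u v b \<and> R \<inter> open_triangle u v b = {} \<and>
        R \<inter> wedge b u v \<noteq> {})"

definition cond_C2 :: "point set \<Rightarrow> point set \<Rightarrow> bool" where
  "cond_C2 R B \<longleftrightarrow> cond_C2_one R B \<or> cond_C2_one B R"

end

theory Submission
  imports Defs
begin

text \<open>
  From C2 to a hole: fix the edge uv and take an apex b witnessing C2 such that no point inside the
  triangle uvb is again such an apex. If at least two blue points lie inside the triangle, then u, v
  and two of them span a hole. If z is the only one, then a red point r of the wedge at b lies in
  the wedge at b spanned by z and one of u, v, say v, and b, z, r, v span a hole for suitable r: no
  blue point of the wedge lies beyond uv, since otherwise a blue segment would cross a red one.

  From a hole to C1 or C2: by Radon's theorem and separability, a balanced convex 4-hole has red
  vertices r1, r2 and blue vertices b1, b2 such that r1 b2 and r2 b1 are its diagonals. Since no red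
  point is inside, the boundary of CH(R) crosses the hole along a single edge uv, which meets both
  sides r1 b1 and r2 b2; likewise for an edge u'v' of CH(B). If neither of the lines uv, u'v' cuts
  the other edge, then these edges see each other. Otherwise, say, the line uv leaves uv at v and
  then cuts u'v'; then v lies in the triangle spanned by u'v' and one of r1, r2, which gives C2.
\<close>

section \<open>Convex hulls and segments\<close>

lemma interior_convex_hull_mono:
  fixes S T :: "'a::real_normed_vector set"
  assumes "T \<subseteq> convex hull S"
  shows "interior (convex hull T) \<subseteq> interior (convex hull S)"
  using assms by (intro interior_mono convex_hull_subset)

lemma minimal_hull_vertex:
  fixes P Y :: "'a::real_normed_vector set"
  assumes "finite Y" "Y \<noteq> {}"
    and vertex: "\<And>y. y \<in> Y \<Longrightarrow> y \<notin> interior (convex hull insert y P)"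
  obtains y where "y \<in> Y" "Y \<inter> interior (convex hull insert y P) = {}"
proof -
  let ?I = "\<lambda>y. Y \<inter> interior (convex hull insert y P)"
  obtain y where y_in: "y \<in> Y" and least: "\<And>x. x \<in> Y \<Longrightarrow> card (?I y) \<le> card (?I x)"
    using ex_has_least_nat[of "\<lambda>y. y \<in> Y" _ "\<lambda>y. card (?I y)"] \<open>Y \<noteq> {}\<close> by blast
  have "x \<notin> ?I y" for x
  proof
    assume x_in: "x \<in> ?I y"
    have "insert x P \<subseteq> convex hull insert y P"
      using x_in interior_subset hull_subset[of "insert y P" convex] by blast
    then have "?I x \<subseteq> ?I y"
      using interior_convex_hull_mono by blast
    then have "?I x \<subset> ?I y"
      using x_in vertex by blast
    then have "card (?I x) < card (?I y)"
      using \<open>finite Y\<close> by (intro psubset_card_mono) auto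
    then show False
      using least[of x] x_in by simp
  qed
  then show thesis
    using that y_in by blast
qed

lemma convex_hull_two_points:
  assumes "p \<in> convex hull T" "p \<notin> T"
  obtains u v where "u \<in> T" "v \<in> T" "u \<noteq> v"
proof -
  obtain u where "u \<in> T"
    using assms(1) by (cases "T = {}") auto
  moreover have "T \<noteq> {u}"
    using assms by auto
  ultimately show thesis
    using that by blast
qed

lemma extreme_point_of_convex_hull_subset:
  assumes "x extreme_point_of convex hull S" "T \<subseteq> convex hull S" "x \<in> convex hull T"
  shows "x \<in> T"
proof -
  have "convex hull T \<subseteq> convex hull S"
    using assms(2) by (rule convex_hull_subset)
  then have "x extreme_point_of convex hull T"
    using assms(1,3) by (auto simp: extreme_point_of_def)
  then show ?thesis
    by (rule extreme_point_of_convex_hull)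
qed

lemma collinear_open_segmentD:
  fixes u v q :: "'a::euclidean_space"
  assumes "collinear {u, v, q}" "u \<noteq> v" "q \<notin> closed_segment u v"
  shows "v \<in> open_segment u q \<or> u \<in> open_segment v q"
proof -
  have "u \<in> closed_segment v q \<or> v \<in> closed_segment u q"
    using assms by (auto simp: collinear_between_cases between_mem_segment closed_segment_commute)
  then show ?thesis
    using assms(2,3) by (auto simp: open_segment_def)
qed

lemma closed_segment_exchange:
  fixes u v p q :: "'a::euclidean_space"
  assumes "p \<in> closed_segment u v" "v \<in> closed_segment u q"
  shows "v \<in> closed_segment p q"
  using assms between_trans_2[of u q v p] between_commute by (metis between_mem_segment)

lemma collinear_beyond_endpoint:
  fixes u v p x :: "'a::euclidean_space"
  assumes "collinear {u, v, x}" "p \<in> open_segment u v" "x \<notin> closed_segment u v"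
  shows "u \<in> open_segment p x \<or> v \<in> open_segment p x"
proof -
  have p_between: "p \<in> closed_segment u v" "p \<in> closed_segment v u" "p \<noteq> u" "p \<noteq> v" "u \<noteq> v"
    using assms(2) by (auto simp: open_segment_def closed_segment_commute)
  have "x \<noteq> u" "x \<noteq> v"
    using assms(3) by auto
  moreover have "v \<in> closed_segment p x \<or> u \<in> closed_segment p x"
    using collinear_open_segmentD[OF assms(1) p_between(5) assms(3)] open_closed_segment
      closed_segment_exchange[OF p_between(1)] closed_segment_exchange[OF p_between(2)] by blast
  ultimately show ?thesis
    using p_between(3,4) by (auto simp: open_segment_def)
qed

lemma line_meets_convex_in_segment:
  fixes u v p x :: "'a::euclidean_space"
  assumes "convex H" "p \<in> interior H" "u \<notin> interior H" "v \<notin> interior H"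
    and "p \<in> open_segment u v" "x \<in> H" "collinear {u, v, x}"
  shows "x \<in> closed_segment u v"
proof (rule ccontr)
  assume "x \<notin> closed_segment u v"
  then have "u \<in> open_segment p x \<or> v \<in> open_segment p x"
    using collinear_beyond_endpoint assms(5,7) by blast
  moreover have "open_segment p x \<subseteq> interior H"
    using assms(1,2,6) closure_subset by (intro in_interior_closure_convex_segment) auto
  ultimately show False
    using assms(3,4) by blast
qed

section \<open>Orientation of point triples\<close>

definition orient :: "point \<Rightarrow> point \<Rightarrow> point \<Rightarrow> real" where
  "orient a b c = (fst b - fst a) * (snd c - snd a) - (snd b - snd a) * (fst c - fst a)"

definition normal :: "point \<Rightarrow> point \<Rightarrow> point" where
  "normal u v = (snd u - snd v, fst v - fst u)"

lemma orient_rotate: "orient b c a = orient a b c"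
  by (simp add: orient_def algebra_simps)

lemma orient_swap: "orient b a c = - orient a b c"
  by (simp add: orient_def algebra_simps)

lemma orient_self [simp]: "orient a b a = 0" "orient a b b = 0" "orient a a b = 0"
  by (simp_all add: orient_def)

lemma orient_combination:
  assumes "\<alpha> + \<beta> + \<gamma> = 1"
  shows "orient u v (\<alpha> *\<^sub>R x + \<beta> *\<^sub>R y + \<gamma> *\<^sub>R z)
       = \<alpha> * orient u v x + \<beta> * orient u v y + \<gamma> * orient u v z"
proof -
  have "\<alpha> = 1 - \<beta> - \<gamma>"
    using assms by simp
  then show ?thesis
    by (simp add: orient_def) (simp add: algebra_simps)
qed

lemma orient_segment:
  "orient u v ((1 - t) *\<^sub>R x + t *\<^sub>R y) = (1 - t) * orient u v x + t * orient u v y"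
  using orient_combination[of "1 - t" t 0 u v x y 0] by simp

lemma orient_midpoint: "orient u v (midpoint x y) = (orient u v x + orient u v y) / 2"
  by (simp add: orient_def midpoint_def field_simps)

lemma orient_eq_0_closed_segment: "x \<in> closed_segment u v \<Longrightarrow> orient u v x = 0"
  by (auto simp: in_segment orient_segment)

lemma collinear_iff_orient: "collinear {a, b, c} \<longleftrightarrow> orient a b c = 0"
proof -
  have "collinear {a, b, c} \<longleftrightarrow> a = b \<or> (\<exists>s. c = s *\<^sub>R a + (1 - s) *\<^sub>R b)"
    using collinear_3_expand[of a c b] by (simp add: insert_commute)
  also have "\<dots> \<longleftrightarrow> orient a b c = 0"
  proof
    assume "a = b \<or> (\<exists>s. c = s *\<^sub>R a + (1 - s) *\<^sub>R b)"
    then show "orient a b c = 0"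
      using orient_segment[of a b "1 - s" a b for s] by auto
  next
    assume zero: "orient a b c = 0"
    show "a = b \<or> (\<exists>s. c = s *\<^sub>R a + (1 - s) *\<^sub>R b)"
    proof (intro disjCI)
      assume "\<nexists>s. c = s *\<^sub>R a + (1 - s) *\<^sub>R b"
      then have not_on_line:
        "\<not> (fst c - fst b = s * (fst a - fst b) \<and> snd c - snd b = s * (snd a - snd b))" for s
        by (simp add: prod_eq_iff algebra_simps)
      have "fst a = fst b"
        using zero not_on_line[of "(fst c - fst b) / (fst a - fst b)"]
        by (auto simp: orient_def divide_simps algebra_simps split: if_splits)
      moreover have "snd a = snd b"
        using zero not_on_line[of "(snd c - snd b) / (snd a - snd b)"]
        by (auto simp: orient_def divide_simps algebra_simps split: if_splits)
      ultimately show "a = b"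
        by (simp add: prod_eq_iff)
    qed
  qed
  finally show ?thesis .
qed

lemma normal_eq_0_iff [simp]: "normal u v = 0 \<longleftrightarrow> u = v"
  by (auto simp: normal_def prod_eq_iff)

lemma orient_eq_inner_normal: "orient u v x = normal u v \<bullet> x - normal u v \<bullet> u"
  by (simp add: orient_def normal_def inner_prod_def algebra_simps)

lemma orthogonal_imp_multiple_of_normal:
  assumes "a \<bullet> u = a \<bullet> v" "u \<noteq> v"
  obtains k where "a = k *\<^sub>R normal u v"
proof -
  have orthogonal: "fst a * (fst v - fst u) + snd a * (snd v - snd u) = 0"
    using assms(1) by (simp add: inner_prod_def algebra_simps)
  consider (horizontal) "fst v - fst u \<noteq> 0" | (vertical) "snd u - snd v \<noteq> 0"
    using assms(2) by (auto simp: prod_eq_iff)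
  then show thesis
  proof cases
    case horizontal
    then have "a = (snd a / (fst v - fst u)) *\<^sub>R normal u v"
      using orthogonal by (simp add: prod_eq_iff normal_def field_simps)
    then show thesis
      by (rule that)
  next
    case vertical
    then have "a = (fst a / (snd u - snd v)) *\<^sub>R normal u v"
      using orthogonal by (simp add: prod_eq_iff normal_def field_simps)
    then show thesis
      by (rule that)
  qed
qed

lemma orthogonal_imp_positive_multiple_of_normal:
  assumes "a \<noteq> 0" "a \<bullet> u = a \<bullet> v" "u \<noteq> v"
  obtains k where "0 < k" "a = k *\<^sub>R normal u v \<or> a = k *\<^sub>R normal v u"
proof -
  obtain k where multiple: "a = k *\<^sub>R normal u v"
    using orthogonal_imp_multiple_of_normal assms(2,3) .
  then have "0 < \<bar>k\<bar>"
    using assms(1) by auto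
  moreover have "a = \<bar>k\<bar> *\<^sub>R normal u v \<or> a = \<bar>k\<bar> *\<^sub>R normal v u"
    unfolding multiple by (auto simp: abs_if normal_def prod_eq_iff algebra_simps)
  ultimately show thesis
    by (rule that)
qed

lemma scaled_orient_halfspace:
  "{x. 0 \<le> k * orient u v x} = {x. (k *\<^sub>R normal u v) \<bullet> u \<le> (k *\<^sub>R normal u v) \<bullet> x}"
  by (simp add: orient_eq_inner_normal right_diff_distrib)

lemma convex_hull_orient_nonneg:
  assumes "\<And>x. x \<in> T \<Longrightarrow> 0 \<le> k * orient u v x" "y \<in> convex hull T"
  shows "0 \<le> k * orient u v y"
proof -
  have "convex {x. 0 \<le> k * orient u v x}"
    unfolding scaled_orient_halfspace by (rule convex_halfspace_ge)
  then have "convex hull T \<subseteq> {x. 0 \<le> k * orient u v x}"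
    using assms(1) by (intro hull_minimal) auto
  then show ?thesis
    using assms(2) by auto
qed

lemma interior_convex_hull_orient_pos:
  assumes "u \<noteq> v" "k \<noteq> 0" "\<And>x. x \<in> T \<Longrightarrow> 0 \<le> k * orient u v x" "y \<in> interior (convex hull T)"
  shows "0 < k * orient u v y"
proof -
  have "convex hull T \<subseteq> {x. 0 \<le> k * orient u v x}"
    using convex_hull_orient_nonneg assms(3) by blast
  then have "y \<in> interior {x. 0 \<le> k * orient u v x}"
    using assms(4) interior_mono by blast
  moreover have "k *\<^sub>R normal u v \<noteq> 0"
    using assms(1,2) by simp
  ultimately have "(k *\<^sub>R normal u v) \<bullet> u < (k *\<^sub>R normal u v) \<bullet> y"
    unfolding scaled_orient_halfspace using interior_halfspace_ge by blast
  then show ?thesis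
    by (simp add: orient_eq_inner_normal right_diff_distrib)
qed

lemma interior_disjoint_opposite_hull:
  assumes "u \<noteq> v" "\<And>x. x \<in> Q \<Longrightarrow> 0 \<le> orient u v x" "\<And>x. x \<in> X \<Longrightarrow> orient u v x \<le> 0"
  shows "interior (convex hull Q) \<inter> convex hull X = {}"
proof -
  have "0 < orient u v x" if "x \<in> interior (convex hull Q)" for x
    using interior_convex_hull_orient_pos[of u v 1 Q x] assms(1,2) that by simp
  moreover have "orient u v x \<le> 0" if "x \<in> convex hull X" for x
    using convex_hull_orient_nonneg[of X "- 1" u v x] assms(3) that by simp
  ultimately show ?thesis
    by force
qed

lemma orient_sgn_along_ray:
  assumes "orient u v p = 0" "q \<in> closed_segment p x" "q \<noteq> p"
  shows "sgn (orient u v q) = sgn (orient u v x)"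
proof -
  obtain t where q_eq: "0 \<le> t" "q = (1 - t) *\<^sub>R p + t *\<^sub>R x"
    using assms(2) by (auto simp: in_segment)
  then have "0 < t"
    using assms(3) by (cases "t = 0") auto
  then show ?thesis
    using q_eq(2) assms(1) by (simp add: orient_segment sgn_mult)
qed

lemma orient_opposite_sides:
  assumes "d \<in> open_segment x y" "orient u v d = 0" "orient u v x \<noteq> 0"
  shows "orient u v x * orient u v y < 0"
proof -
  obtain t where d_eq: "0 < t" "t < 1" "d = (1 - t) *\<^sub>R x + t *\<^sub>R y"
    using assms(1) by (auto simp: in_segment)
  then have "t * orient u v y = - ((1 - t) * orient u v x)"
    using assms(2) by (simp add: orient_segment)
  then have "t * (orient u v x * orient u v y) = - ((1 - t) * (orient u v x)\<^sup>2)"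
    by (simp add: power2_eq_square mult.left_commute[of t])
  also have "\<dots> < 0"
    using d_eq assms(3) by simp
  finally show ?thesis
    using d_eq(1) by (simp add: mult_less_0_iff)
qed

lemma orient_sign_change:
  assumes "orient u v x \<le> 0" "0 \<le> orient u v y"
  shows "\<exists>q\<in>closed_segment x y. orient u v q = 0"
  using connected_ivt_hyperplane[of "closed_segment x y" x y "normal u v" "normal u v \<bullet> u"] assms
  by (simp add: orient_eq_inner_normal)

section \<open>Triangles and convex position\<close>

lemma open_triangle_commute: "open_triangle v u x = open_triangle u v x"
  by (simp add: open_triangle_def insert_commute)

lemma open_triangle_subset_hull: "open_triangle a b c \<subseteq> convex hull {a, b, c}"
  unfolding open_triangle_def by (rule interior_subset)

lemma open_triangle_mono:
  assumes "z \<in> open_triangle u v b"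
  shows "open_triangle u v z \<subseteq> open_triangle u v b"
proof -
  have "{u, v, z} \<subseteq> convex hull {u, v, b}"
    using assms open_triangle_subset_hull hull_subset[of "{u, v, b}" convex] by blast
  then show ?thesis
    unfolding open_triangle_def by (rule interior_convex_hull_mono)
qed

lemma open_triangle_iff:
  assumes "orient a b c \<noteq> 0"
  shows "x \<in> open_triangle a b c \<longleftrightarrow>
    (\<exists>\<alpha> \<beta> \<gamma>. 0 < \<alpha> \<and> 0 < \<beta> \<and> 0 < \<gamma> \<and> \<alpha> + \<beta> + \<gamma> = 1 \<and> x = \<alpha> *\<^sub>R a + \<beta> *\<^sub>R b + \<gamma> *\<^sub>R c)"
  using interior_convex_hull_3_minimal[of a b c] assms
  by (auto simp: open_triangle_def collinear_iff_orient)

lemma triangle_vertex_extreme: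
  assumes "orient a b c \<noteq> 0" "x \<in> {a, b, c}"
  shows "x extreme_point_of convex hull {a, b, c}"
proof -
  have "\<not> affine_dependent {a, b, c}"
    using assms(1) by (auto simp: collinear_3_eq_affine_dependent simp flip: collinear_iff_orient)
  then show ?thesis
    using assms(2) by (simp add: extreme_point_of_convex_hull_affine_independent)
qed

lemma triangle_vertex_notin_open_triangle:
  assumes "orient a b c \<noteq> 0" "x \<in> {a, b, c}"
  shows "x \<notin> open_triangle a b c"
  using triangle_vertex_extreme[OF assms] unfolding open_triangle_def
  by (rule extreme_point_not_in_interior)

lemma convex_position_notin_interior:
  assumes "finite Q" "convex_position Q" "q \<in> Q"
  shows "q \<notin> interior (convex hull Q)"
proof -
  have "q extreme_point_of (convex hull Q)"
    using assms extreme_point_of_convex_hull_insert[of "Q - {q}" q]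
    by (simp add: convex_position_def insert_absorb)
  then show ?thesis
    by (rule extreme_point_not_in_interior)
qed

lemma convex_position_4I:
  assumes "a \<notin> convex hull {b, c, d}" "b \<notin> convex hull {a, c, d}"
    "c \<notin> convex hull {a, b, d}" "d \<notin> convex hull {a, b, c}"
  shows "convex_position {a, b, c, d}"
proof -
  have "convex hull ({a, b, c, d} - {a}) \<subseteq> convex hull {b, c, d}"
    "convex hull ({a, b, c, d} - {b}) \<subseteq> convex hull {a, c, d}"
    "convex hull ({a, b, c, d} - {c}) \<subseteq> convex hull {a, b, d}"
    "convex hull ({a, b, c, d} - {d}) \<subseteq> convex hull {a, b, c}"
    by (intro hull_mono; blast)+
  then show ?thesis
    using assms unfolding convex_position_def by blast
qed

lemma convex_position_inner_pair:
  assumes "orient u v b \<noteq> 0" "x \<in> open_triangle u v b" "y \<in> open_triangle u v b"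
    and "x \<notin> convex hull {u, v, y}" "y \<notin> convex hull {u, v, x}"
  shows "convex_position {u, v, x, y}"
proof -
  have "u \<noteq> v"
    using assms(1) by auto
  have corner: "p \<notin> convex hull {q, x, y}" if "p \<in> {u, v}" "q \<in> {u, v}" "p \<noteq> q" for p q
  proof
    assume "p \<in> convex hull {q, x, y}"
    moreover have "{q, x, y} \<subseteq> convex hull {u, v, b}"
      using that(2) assms(2,3) open_triangle_subset_hull hull_subset[of "{u, v, b}" convex] by blast
    moreover have "p extreme_point_of convex hull {u, v, b}"
      using that(1) by (intro triangle_vertex_extreme assms(1)) auto
    ultimately have "p \<in> {q, x, y}"
      using extreme_point_of_convex_hull_subset by blast
    then show False
      using that assms(1-3) triangle_vertex_notin_open_triangle by blast
  qed
  show ?thesis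
    using corner[of u v] corner[of v u] \<open>u \<noteq> v\<close> assms(4,5) by (intro convex_position_4I) auto
qed

lemma line_point_notin_convex_hull:
  assumes "p \<noteq> q" "orient u v p = 0" "orient u v q = 0" "0 < orient u v x" "0 < orient u v y"
  shows "p \<notin> convex hull {q, x, y}"
proof
  assume "p \<in> convex hull {q, x, y}"
  then obtain \<alpha> \<beta> \<gamma> where p_eq: "0 \<le> \<beta>" "0 \<le> \<gamma>" "\<alpha> + \<beta> + \<gamma> = 1"
      "p = \<alpha> *\<^sub>R q + \<beta> *\<^sub>R x + \<gamma> *\<^sub>R y"
    by (auto simp: convex_hull_3)
  have "\<beta> * orient u v x + \<gamma> * orient u v y = 0"
    using assms(2,3) p_eq(3) by (simp add: p_eq(4) orient_combination)
  moreover have "\<beta> * orient u v x \<ge> 0" "\<gamma> * orient u v y \<ge> 0"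
    using p_eq assms by auto
  ultimately have "\<beta> * orient u v x = 0" "\<gamma> * orient u v y = 0"
    by linarith+
  then have "\<beta> = 0" "\<gamma> = 0"
    using assms(4,5) by auto
  then show False
    using assms(1) p_eq by simp
qed

lemma convex_position_facing_segments:
  assumes "u \<noteq> v" "0 < orient u v u'" "0 < orient u v v'"
    and "u' \<noteq> v'" "0 < orient u' v' u" "0 < orient u' v' v"
  shows "convex_position {u, v, u', v'}"
  using assms
    line_point_notin_convex_hull[of u v u v u' v'] line_point_notin_convex_hull[of v u u v u' v']
    line_point_notin_convex_hull[of u' v' u' v' u v] line_point_notin_convex_hull[of v' u' u' v' u v]
  by (intro convex_position_4I) (auto simp: insert_commute)

lemma opposite_side_notin_convex_hull:
  assumes "orient u v x * orient u v y < 0"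
  shows "x \<notin> convex hull {u, v, y}"
proof
  assume "x \<in> convex hull {u, v, y}"
  then have "0 \<le> orient u v y * orient u v x"
    by (rule convex_hull_orient_nonneg[rotated]) auto
  then show False
    using assms by (simp add: mult.commute)
qed

lemma convex_position_crossing_segments:
  assumes "d \<in> open_segment a c" "d \<in> open_segment b e" "orient b e a \<noteq> 0" "orient a c b \<noteq> 0"
  shows "convex_position {a, b, c, e}"
proof -
  have "orient b e d = 0" "orient a c d = 0"
    using assms(1,2) open_closed_segment orient_eq_0_closed_segment by blast+
  then have "orient b e a * orient b e c < 0" "orient a c b * orient a c e < 0"
    using orient_opposite_sides assms by blast+
  then show ?thesis
    using opposite_side_notin_convex_hull[of b e a c] opposite_side_notin_convex_hull[of b e c a]
      opposite_side_notin_convex_hull[of a c b e] opposite_side_notin_convex_hull[of a c e b]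
    by (intro convex_position_4I) (auto simp: insert_commute mult.commute)
qed

section \<open>Wedges\<close>

lemma scaled_wedgeI:
  assumes "0 < k" "0 < s" "0 < t" "k *\<^sub>R (x - a) = s *\<^sub>R (b - a) + t *\<^sub>R (c - a)"
  shows "x \<in> wedge a b c"
proof -
  have "x - a = (1 / k) *\<^sub>R (k *\<^sub>R (x - a))"
    using assms(1) by simp
  also have "\<dots> = (s / k) *\<^sub>R (b - a) + (t / k) *\<^sub>R (c - a)"
    unfolding assms(4) by (simp add: scaleR_add_right)
  finally have "x = a + (s / k) *\<^sub>R (b - a) + (t / k) *\<^sub>R (c - a)"
    by (simp only: diff_eq_eq add_ac)
  moreover have "0 < s / k" "0 < t / k"
    using assms(1-3) by auto
  ultimately show ?thesis
    unfolding wedge_def by blast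
qed

lemma wedge_iff_orient:
  assumes "orient a b c \<noteq> 0"
  shows "x \<in> wedge a b c \<longleftrightarrow> 0 < orient a b c * orient a b x \<and> 0 < orient a b c * orient a x c"
proof
  assume "x \<in> wedge a b c"
  then obtain s t where x_eq: "x = a + s *\<^sub>R (b - a) + t *\<^sub>R (c - a)" and pos: "s > 0" "t > 0"
    unfolding wedge_def by blast
  have "orient a b x = t * orient a b c" "orient a x c = s * orient a b c"
    unfolding x_eq by (simp_all add: orient_def algebra_simps)
  then show "0 < orient a b c * orient a b x \<and> 0 < orient a b c * orient a x c"
    using assms pos by (auto simp: zero_less_mult_iff mult_less_0_iff linorder_neq_iff)
next
  assume pos: "0 < orient a b c * orient a b x \<and> 0 < orient a b c * orient a x c"
  define s where "s = orient a x c / orient a b c"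
  define t where "t = orient a b x / orient a b c"
  have
    "orient a b c * (fst x - fst a) = orient a x c * (fst b - fst a) + orient a b x * (fst c - fst a)"
    "orient a b c * (snd x - snd a) = orient a x c * (snd b - snd a) + orient a b x * (snd c - snd a)"
    by (simp_all add: orient_def algebra_simps)
  then have "fst x - fst a = s * (fst b - fst a) + t * (fst c - fst a)"
    "snd x - snd a = s * (snd b - snd a) + t * (snd c - snd a)"
    using assms
    by (simp_all add: s_def t_def nonzero_eq_divide_eq add_divide_distrib[symmetric] mult.commute)
  then have "x = a + s *\<^sub>R (b - a) + t *\<^sub>R (c - a)"
    by (simp add: prod_eq_iff)
  moreover have "s > 0" "t > 0"
    using pos by (auto simp: s_def t_def zero_less_divide_iff zero_less_mult_iff)
  ultimately show "x \<in> wedge a b c"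
    unfolding wedge_def by blast
qed

lemma wedge_vertex_notin:
  assumes "orient a b c \<noteq> 0" "x \<in> {a, b, c}"
  shows "x \<notin> wedge a b c"
  using assms by (auto simp: wedge_iff_orient)

lemma interior_convex_hull_subset_wedge:
  assumes "orient a b c \<noteq> 0" "x \<in> wedge a b c"
  shows "interior (convex hull {x, a, b, c}) \<subseteq> wedge a b c"
proof
  fix y
  assume y_in: "y \<in> interior (convex hull {x, a, b, c})"
  have "0 \<le> orient a b c * orient a b p" "0 \<le> orient a b c * orient c a p"
    if "p \<in> {x, a, b, c}" for p
    using that assms orient_rotate[of a x c] orient_rotate[of a b c] by (auto simp: wedge_iff_orient)
  moreover have "a \<noteq> b" "c \<noteq> a"
    using assms(1) by auto
  ultimately have "0 < orient a b c * orient a b y" "0 < orient a b c * orient c a y"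
    using interior_convex_hull_orient_pos[OF _ assms(1) _ y_in] by blast+
  then show "y \<in> wedge a b c"
    using assms(1) orient_rotate[of a y c] by (simp add: wedge_iff_orient)
qed

lemma open_triangle_subset_wedge:
  assumes "orient a b c \<noteq> 0"
  shows "open_triangle b c a \<subseteq> wedge a b c"
proof
  fix x
  assume "x \<in> open_triangle b c a"
  then have "x \<in> open_triangle a b c"
    by (simp add: open_triangle_def insert_commute)
  then obtain \<alpha> \<beta> \<gamma> where x_eq: "0 < \<beta>" "0 < \<gamma>" "\<alpha> + \<beta> + \<gamma> = 1" "x = \<alpha> *\<^sub>R a + \<beta> *\<^sub>R b + \<gamma> *\<^sub>R c"
    using open_triangle_iff[OF assms] by blast
  have \<alpha>_eq: "\<alpha> = 1 - \<beta> - \<gamma>"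
    using x_eq(3) by simp
  have "x = a + \<beta> *\<^sub>R (b - a) + \<gamma> *\<^sub>R (c - a)"
    unfolding x_eq(4) \<alpha>_eq by (simp add: algebra_simps)
  then show "x \<in> wedge a b c"
    unfolding wedge_def using x_eq(1,2) by blast
qed

lemma open_segment_subset_wedge: "open_segment b c \<subseteq> wedge a b c"
proof
  fix x
  assume "x \<in> open_segment b c"
  then obtain t where x_eq: "0 < t" "t < 1" "x = (1 - t) *\<^sub>R b + t *\<^sub>R c"
    by (auto simp: in_segment)
  then have "x = a + (1 - t) *\<^sub>R (b - a) + t *\<^sub>R (c - a)"
    by (simp add: algebra_simps)
  then show "x \<in> wedge a b c"
    unfolding wedge_def using x_eq(1,2) by force
qed

lemma wedge_ray:
  assumes "d \<in> wedge a b c" "d \<in> open_segment a x"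
  shows "x \<in> wedge a b c"
proof -
  obtain s t where d_eq: "0 < s" "0 < t" "d = a + s *\<^sub>R (b - a) + t *\<^sub>R (c - a)"
    using assms(1) by (auto simp: wedge_def)
  obtain k where d_on_ray: "0 < k" "d = (1 - k) *\<^sub>R a + k *\<^sub>R x"
    using assms(2) by (auto simp: in_segment)
  have "k *\<^sub>R (x - a) = d - a"
    unfolding d_on_ray(2) by (simp add: algebra_simps)
  then show ?thesis
    using d_eq d_on_ray(1) by (intro scaled_wedgeI[of k s t]) auto
qed

lemma wedge_open_segment_to_side:
  assumes "x \<in> wedge a b c" "d \<in> open_segment x b"
  shows "d \<in> wedge a b c"
proof -
  obtain s t where x_eq: "0 < s" "0 < t" "x = a + s *\<^sub>R (b - a) + t *\<^sub>R (c - a)"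
    using assms(1) by (auto simp: wedge_def)
  obtain k where d_eq: "0 < k" "k < 1" "d = (1 - k) *\<^sub>R x + k *\<^sub>R b"
    using assms(2) by (auto simp: in_segment)
  have "d = a + ((1 - k) * s + k) *\<^sub>R (b - a) + ((1 - k) * t) *\<^sub>R (c - a)"
    unfolding d_eq(3) x_eq(3) by (simp add: algebra_simps)
  moreover have "0 < (1 - k) * s + k" "0 < (1 - k) * t"
    using x_eq(1,2) d_eq(1,2) by (auto intro: add_pos_pos)
  ultimately show ?thesis
    unfolding wedge_def by blast
qed

lemma wedge_subset_wedge:
  assumes "z \<in> wedge a b c"
  shows "wedge a z c \<subseteq> wedge a b c"
proof
  fix x
  assume "x \<in> wedge a z c"
  then obtain k l where x_eq: "0 < k" "0 < l" "x = a + k *\<^sub>R (z - a) + l *\<^sub>R (c - a)"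
    by (auto simp: wedge_def)
  obtain s t where z_eq: "0 < s" "0 < t" "z = a + s *\<^sub>R (b - a) + t *\<^sub>R (c - a)"
    using assms by (auto simp: wedge_def)
  have "x = a + (k * s) *\<^sub>R (b - a) + (k * t + l) *\<^sub>R (c - a)"
    unfolding x_eq(3) z_eq(3) by (simp add: algebra_simps)
  moreover have "0 < k * s" "0 < k * t + l"
    using x_eq(1,2) z_eq(1,2) by (auto intro: add_pos_pos)
  ultimately show "x \<in> wedge a b c"
    unfolding wedge_def by blast
qed

lemma wedge_split:
  assumes "orient a b c \<noteq> 0" "z \<in> wedge a b c" "x \<in> wedge a b c" "orient a z x \<noteq> 0"
  shows "x \<in> wedge a z c \<or> x \<in> wedge a z b"
proof -
  have "orient a z b = - orient a b z" "orient a x b = - orient a b x"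
    using orient_rotate orient_swap by metis+
  moreover have "0 < orient a b c * orient a b z" "0 < orient a b c * orient a z c"
    "0 < orient a b c * orient a b x" "0 < orient a b c * orient a x c"
    using assms(1-3) by (auto simp: wedge_iff_orient)
  ultimately show ?thesis
    using assms(4) wedge_iff_orient[of a z c x] wedge_iff_orient[of a z b x]
    by (auto simp: zero_less_mult_iff mult_less_0_iff linorder_neq_iff)
qed

lemma wedge_crosses_base:
  assumes "x \<in> wedge b u v" "x \<notin> convex hull {u, v, b}" "u \<noteq> v"
  obtains d where "d \<in> open_segment b x" "d \<in> open_segment u v"
proof -
  obtain s t where x_eq: "0 < s" "0 < t" "x = b + s *\<^sub>R (u - b) + t *\<^sub>R (v - b)"
    using assms(1) by (auto simp: wedge_def)
  have "1 < s + t"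
  proof (rule ccontr)
    assume "\<not> 1 < s + t"
    moreover have "x = s *\<^sub>R u + t *\<^sub>R v + (1 - s - t) *\<^sub>R b"
      unfolding x_eq(3) by (simp add: algebra_simps)
    ultimately have "x \<in> convex hull {u, v, b}"
      unfolding convex_hull_3 using x_eq(1,2)
      by (intro CollectI exI[of _ s] exI[of _ t] exI[of _ "1 - s - t"]) auto
    then show False
      using assms(2) by simp
  qed
  define d where "d = (1 - t / (s + t)) *\<^sub>R u + (t / (s + t)) *\<^sub>R v"
  have "d \<in> open_segment u v"
    unfolding in_segment d_def using x_eq(1,2) assms(3) by (intro conjI exI[of _ "t / (s + t)"]) auto
  moreover have "d = (1 - 1 / (s + t)) *\<^sub>R b + (1 / (s + t)) *\<^sub>R x"
    unfolding d_def x_eq(3) using x_eq(1,2) by (simp add: prod_eq_iff) (simp add: field_simps)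
  moreover have "b \<noteq> x"
    using assms(2) hull_subset[of "{u, v, b}" convex] by auto
  moreover have "0 < 1 / (s + t)" "1 / (s + t) < 1"
    using \<open>1 < s + t\<close> by auto
  ultimately have "d \<in> open_segment b x" "d \<in> open_segment u v"
    unfolding in_segment by blast+
  then show thesis
    by (rule that)
qed

lemma wedge_of_inner_apex:
  assumes "orient u v b \<noteq> 0" "z \<in> open_triangle u v b" "d \<in> open_segment b x" "d \<in> open_segment u v"
  shows "x \<in> wedge z u v"
proof -
  obtain \<alpha> \<beta> \<gamma> where z_eq: "0 < \<alpha>" "0 < \<beta>" "0 < \<gamma>" "\<alpha> + \<beta> + \<gamma> = 1"
      "z = \<alpha> *\<^sub>R u + \<beta> *\<^sub>R v + \<gamma> *\<^sub>R b"
    using assms(1,2) open_triangle_iff by blast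
  then have \<alpha>_eq: "\<alpha> = 1 - \<beta> - \<gamma>"
    by simp
  obtain k where d_on_ray: "0 < k" "k < 1" "d = (1 - k) *\<^sub>R b + k *\<^sub>R x"
    using assms(3) by (auto simp: in_segment)
  obtain t where d_on_base: "0 < t" "t < 1" "d = (1 - t) *\<^sub>R u + t *\<^sub>R v"
    using assms(4) by (auto simp: in_segment)
  let ?c = "(1 - k) / \<gamma>"
  have "k *\<^sub>R (x - z) = (d - z) + (1 - k) *\<^sub>R (z - b)"
    unfolding d_on_ray(3) by (simp add: algebra_simps)
  also have "\<dots> = (d - z) + ?c *\<^sub>R (\<gamma> *\<^sub>R (z - b))"
    using z_eq(3) by simp
  also have "\<gamma> *\<^sub>R (z - b) = \<alpha> *\<^sub>R (u - z) + \<beta> *\<^sub>R (v - z)"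
    unfolding z_eq(5) \<alpha>_eq by (simp add: prod_eq_iff) (simp add: algebra_simps)
  also have "(d - z) + ?c *\<^sub>R \<dots> = (1 - t + ?c * \<alpha>) *\<^sub>R (u - z) + (t + ?c * \<beta>) *\<^sub>R (v - z)"
    unfolding d_on_base(3) by (simp add: algebra_simps)
  finally have "k *\<^sub>R (x - z) = (1 - t + ?c * \<alpha>) *\<^sub>R (u - z) + (t + ?c * \<beta>) *\<^sub>R (v - z)" .
  moreover have "0 < 1 - t + ?c * \<alpha>" "0 < t + ?c * \<beta>"
    using z_eq d_on_ray(2) d_on_base(1,2) by (auto intro!: add_pos_pos)
  ultimately show ?thesis
    using d_on_ray(1) by (intro scaled_wedgeI)
qed

section \<open>General position\<close>

lemma general_position_orient:
  assumes "general_position S" "a \<in> S" "b \<in> S" "c \<in> S" "a \<noteq> b" "a \<noteq> c" "b \<noteq> c"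
  shows "orient a b c \<noteq> 0"
  using assms unfolding general_position_def collinear_iff_orient by blast

lemma general_position_closed_segment:
  assumes "general_position S" "{a, b, c} \<subseteq> S" "c \<in> closed_segment a b"
  shows "c = a \<or> c = b"
  using assms general_position_orient[of S a b c] orient_eq_0_closed_segment[of c a b]
  by (cases "a = b") auto

lemma general_position_open_triangle:
  assumes "general_position S" "{a, b, c, x} \<subseteq> S" "orient a b c \<noteq> 0"
    and "x \<in> convex hull {a, b, c}" "x \<notin> {a, b, c}"
  shows "x \<in> open_triangle a b c"
proof -
  obtain \<alpha> \<beta> \<gamma> where x_eq: "0 \<le> \<alpha>" "0 \<le> \<beta>" "0 \<le> \<gamma>" "\<alpha> + \<beta> + \<gamma> = 1"
      "x = \<alpha> *\<^sub>R a + \<beta> *\<^sub>R b + \<gamma> *\<^sub>R c"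
    using assms(4) by (auto simp: convex_hull_3)
  have "a \<noteq> b" "a \<noteq> c" "b \<noteq> c"
    using assms(3) by auto
  then have "orient a b x \<noteq> 0" "orient b c x \<noteq> 0" "orient c a x \<noteq> 0"
    using general_position_orient[OF assms(1), of _ _ x] assms(2,5) by blast+
  moreover have "orient a b x = \<gamma> * orient a b c" "orient b c x = \<alpha> * orient b c a"
    "orient c a x = \<beta> * orient c a b"
    by (simp_all add: x_eq(5) orient_combination[OF x_eq(4)])
  ultimately have "0 < \<alpha>" "0 < \<beta>" "0 < \<gamma>"
    using x_eq(1-3) by (auto simp: less_le)
  then show ?thesis
    using x_eq open_triangle_iff[OF assms(3)] by blast
qed

lemma general_position_crossing_segments:
  assumes "general_position S" "{a, b, c, d} \<subseteq> S" "{a, b} \<inter> {c, d} = {}"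
    and "q \<in> closed_segment a b" "q \<in> closed_segment c d"
  shows "q \<in> open_segment a b" "q \<in> open_segment c d"
  using assms general_position_closed_segment[of S a b q] general_position_closed_segment[of S c d q]
  by (auto simp: open_segment_def)

section \<open>Bicolored point sets\<close>

text \<open>
  Separability enters only through the disjointness of the two hulls, which is symmetric in the colors.
\<close>

locale bicolored_points =
  fixes R B :: "point set"
  assumes finite_red: "finite R" and finite_blue: "finite B"
    and in_general_position: "general_position (R \<union> B)"
    and hulls_disjoint: "convex hull R \<inter> convex hull B = {}"
begin

sublocale swap: bicolored_points B R
  using finite_red finite_blue in_general_position hulls_disjoint
  by unfold_locales (simp_all add: Un_commute Int_commute)

lemma colors_disjoint: "R \<inter> B = {}"
  using hulls_disjoint hull_subset[of R convex] hull_subset[of B convex] by blast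

lemma orient_neq_0:
  assumes "{a, b, c} \<subseteq> R \<union> B" "a \<noteq> b" "a \<noteq> c" "b \<noteq> c"
  shows "orient a b c \<noteq> 0"
  using assms general_position_orient[OF in_general_position] by simp

lemma orient_red_red_blue_neq_0:
  assumes "u \<in> R" "v \<in> R" "u \<noteq> v" "b \<in> B"
  shows "orient u v b \<noteq> 0"
  using assms colors_disjoint by (intro orient_neq_0) auto

lemma red_blue_segments_disjoint:
  assumes "{u, v} \<subseteq> R" "{b, b'} \<subseteq> B"
  shows "closed_segment u v \<inter> closed_segment b b' = {}"
  using assms hulls_disjoint hull_mono[of "{u, v}" R convex] hull_mono[of "{b, b'}" B convex]
  by (auto simp: segment_convex_hull)

lemma red_precedes_blue_on_segment:
  assumes "b \<in> convex hull B" "p \<in> closed_segment r b" "p \<in> convex hull R"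
    and "q \<in> closed_segment r b" "q \<in> convex hull B"
  shows "p \<in> closed_segment r q"
proof -
  have "closed_segment q b \<subseteq> convex hull B"
    using assms(1,5) by (simp add: closed_segment_subset_convex_hull)
  then have "p \<notin> closed_segment q b"
    using assms(3) hulls_disjoint by blast
  then show ?thesis
    using Un_closed_segment[OF assms(4)] assms(2) by blast
qed

lemma balanced_convex_4holeI:
  assumes "u \<in> R" "v \<in> R" "u \<noteq> v" "x \<in> B" "y \<in> B" "x \<noteq> y"
    and "convex_position {u, v, x, y}" "(R \<union> B) \<inter> interior (convex hull {u, v, x, y}) = {}"
  shows "balanced_convex_4hole R B {u, v, x, y}"
proof -
  have "{u, v, x, y} \<inter> R = {u, v}" "{u, v, x, y} \<inter> B = {x, y}"
    using assms(1,2,4,5) colors_disjoint by auto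
  moreover have "{u, v} \<inter> {x, y} = {}"
    using assms(1,2,4,5) colors_disjoint by blast
  then have "card {u, v, x, y} = 4"
    using assms(3,6) by auto
  ultimately show ?thesis
    using assms by (simp add: balanced_convex_4hole_def)
qed

end

lemma balanced_convex_4hole_commute: "balanced_convex_4hole B R Q \<longleftrightarrow> balanced_convex_4hole R B Q"
  by (auto simp: balanced_convex_4hole_def Un_commute)

lemma linearly_separable_imp_hulls_disjoint:
  assumes "linearly_separable R B"
  shows "convex hull R \<inter> convex hull B = {}"
proof -
  obtain w c where "\<forall>r\<in>R. w \<bullet> r < c" "\<forall>b\<in>B. w \<bullet> b > c"
    using assms unfolding linearly_separable_def by blast
  then have "convex hull R \<subseteq> {x. w \<bullet> x < c}" "convex hull B \<subseteq> {x. w \<bullet> x > c}"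
    by (intro hull_minimal convex_halfspace_lt convex_halfspace_gt; blast)+
  then show ?thesis
    by fastforce
qed

section \<open>Conditions C1 and C2 yield a hole\<close>

definition C2_apex :: "point set \<Rightarrow> point set \<Rightarrow> point \<Rightarrow> point \<Rightarrow> point \<Rightarrow> bool" where
  "C2_apex R B u v b \<longleftrightarrow>
     b \<in> B \<and> B \<inter> open_triangle u v b \<noteq> {} \<and> R \<inter> open_triangle u v b = {} \<and> R \<inter> wedge b u v \<noteq> {}"

lemma cond_C2_one_iff: "cond_C2_one R B \<longleftrightarrow> (\<exists>u v b. hull_edge R u v \<and> C2_apex R B u v b)"
  unfolding cond_C2_one_def C2_apex_def by blast

context bicolored_points
begin

lemma wedge_crosses_edge:
  assumes "{u, v, b, x} \<subseteq> R \<union> B" "orient u v b \<noteq> 0" "x \<in> wedge b u v" "x \<notin> open_triangle u v b"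
  obtains d where "d \<in> open_segment b x" "d \<in> open_segment u v"
proof (rule wedge_crosses_base[OF assms(3)])
  have "orient b u v \<noteq> 0"
    using assms(2) by (simp add: orient_rotate)
  then have "x \<notin> {u, v, b}"
    using assms(3) wedge_vertex_notin by blast
  then show "x \<notin> convex hull {u, v, b}"
    using assms general_position_open_triangle[OF in_general_position] by blast
  show "u \<noteq> v"
    using assms(2) by auto
qed (rule that)

lemma blue_in_wedge_imp_in_triangle:
  assumes "{u, v} \<subseteq> R" "{b, x} \<subseteq> B" "orient u v b \<noteq> 0" "x \<in> wedge b u v"
  shows "x \<in> open_triangle u v b"
proof (rule ccontr)
  assume "x \<notin> open_triangle u v b"
  then obtain d where "d \<in> open_segment b x" "d \<in> open_segment u v"
    using assms wedge_crosses_edge[of u v b x] by auto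
  then show False
    using red_blue_segments_disjoint[OF assms(1,2)] open_closed_segment by blast
qed

lemma C2_apex_inner:
  assumes "{u, v} \<subseteq> R" "orient u v b \<noteq> 0" "C2_apex R B u v b"
    and "z \<in> B \<inter> open_triangle u v b" "B \<inter> open_triangle u v z \<noteq> {}"
  shows "C2_apex R B u v z"
proof -
  obtain r where red_in_wedge: "r \<in> R" "r \<in> wedge b u v"
    using assms(3) by (auto simp: C2_apex_def)
  have "b \<in> B" "r \<notin> open_triangle u v b"
    using assms(3) red_in_wedge(1) by (auto simp: C2_apex_def)
  then obtain d where "d \<in> open_segment b r" "d \<in> open_segment u v"
    using wedge_crosses_edge[of u v b r] assms(1,2) red_in_wedge by auto
  then have "r \<in> wedge z u v"
    using wedge_of_inner_apex assms(2,4) by blast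
  moreover have "open_triangle u v z \<subseteq> open_triangle u v b"
    using assms(4) open_triangle_mono by blast
  ultimately show ?thesis
    using assms(3-5) red_in_wedge(1) by (auto simp: C2_apex_def)
qed

lemma minimal_C2_apex:
  assumes "u \<in> R" "v \<in> R" "u \<noteq> v" "C2_apex R B u v b0"
  obtains b where "C2_apex R B u v b"
    "\<And>z. z \<in> B \<inter> open_triangle u v b \<Longrightarrow> B \<inter> open_triangle u v z = {}"
proof -
  let ?Y = "{b. C2_apex R B u v b}"
  have "?Y \<subseteq> B"
    by (auto simp: C2_apex_def)
  have hull_eq: "interior (convex hull insert b {u, v}) = open_triangle u v b" for b
    by (simp add: open_triangle_def insert_commute)
  have apex_outside: "b \<notin> open_triangle u v b" if "b \<in> ?Y" for b
    using triangle_vertex_notin_open_triangle orient_red_red_blue_neq_0[OF assms(1-3)] that \<open>?Y \<subseteq> B\<close>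
    by blast
  have "finite ?Y" "?Y \<noteq> {}"
    using finite_subset[OF \<open>?Y \<subseteq> B\<close> finite_blue] assms(4) by blast+
  then obtain b where minimal: "b \<in> ?Y" "?Y \<inter> open_triangle u v b = {}"
    by (rule minimal_hull_vertex[of ?Y "{u, v}", unfolded hull_eq, OF _ _ apex_outside])
  then have "orient u v b \<noteq> 0"
    using orient_red_red_blue_neq_0[OF assms(1-3)] by (simp add: C2_apex_def)
  then show thesis
    using that[of b] C2_apex_inner[of u v b] assms(1,2) minimal by blast
qed

lemma blue_notin_empty_triangle:
  assumes "u \<in> R" "v \<in> R" "u \<noteq> v" "y \<in> B" "z \<in> B" "y \<noteq> z" "B \<inter> open_triangle u v z = {}"
  shows "y \<notin> convex hull {u, v, z}"
proof
  assume "y \<in> convex hull {u, v, z}"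
  moreover have "y \<notin> {u, v, z}"
    using assms(1,2,4,6) colors_disjoint by auto
  ultimately have "y \<in> open_triangle u v z"
    using assms(1-5) orient_red_red_blue_neq_0
    by (intro general_position_open_triangle[OF in_general_position]) auto
  then show False
    using assms(4,7) by blast
qed

lemma hole_of_two_inner_points:
  assumes "u \<in> R" "v \<in> R" "orient u v b \<noteq> 0"
    and empty: "R \<inter> open_triangle u v b = {}"
    and antichain: "\<And>z. z \<in> B \<inter> open_triangle u v b \<Longrightarrow> B \<inter> open_triangle u v z = {}"
    and x_inner: "x \<in> B \<inter> open_triangle u v b" and "x' \<in> B \<inter> open_triangle u v b" "x' \<noteq> x"
  shows "\<exists>Q. balanced_convex_4hole R B Q"
proof -
  let ?T = "B \<inter> open_triangle u v b"
  have "u \<noteq> v"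
    using assms(3) by auto
  then have "y \<notin> convex hull {u, v, z}" if "y \<in> ?T" "z \<in> ?T" "y \<noteq> z" for y z
    using that assms(1,2) antichain by (intro blue_notin_empty_triangle) auto
  then have position: "convex_position {u, v, x, y}" if "y \<in> ?T - {x}" for y
    using that x_inner assms(3) convex_position_inner_pair[of u v b x y] by blast
  have "y \<notin> interior (convex hull insert y {u, v, x})" if "y \<in> ?T - {x}" for y
    using convex_position_notin_interior[OF _ position[OF that], of y] by (simp add: insert_commute)
  then obtain y where y_minimal: "y \<in> ?T - {x}"
      "(?T - {x}) \<inter> interior (convex hull insert y {u, v, x}) = {}"
    using minimal_hull_vertex[of "?T - {x}" "{u, v, x}"] finite_blue assms(7,8) by blast
  have "insert y {u, v, x} = {u, v, x, y}"
    by auto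
  then have blue_free: "(?T - {x}) \<inter> interior (convex hull {u, v, x, y}) = {}"
    using y_minimal(2) by simp
  have "x \<in> convex hull {u, v, b}" "y \<in> convex hull {u, v, b}"
    using x_inner y_minimal(1) open_triangle_subset_hull by blast+
  then have "{u, v, x, y} \<subseteq> convex hull {u, v, b}"
    using hull_subset[of "{u, v, b}" convex] by blast
  then have "interior (convex hull {u, v, x, y}) \<subseteq> open_triangle u v b"
    unfolding open_triangle_def by (rule interior_convex_hull_mono)
  moreover have "x \<notin> interior (convex hull {u, v, x, y})"
    using convex_position_notin_interior[OF _ position[OF y_minimal(1)]] by simp
  ultimately have "(R \<union> B) \<inter> interior (convex hull {u, v, x, y}) = {}"
    using blue_free empty by blast
  then show ?thesis
    using balanced_convex_4holeI[of u v x y] assms(1,2) \<open>u \<noteq> v\<close> x_inner y_minimal(1)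
      position[OF y_minimal(1)] by blast
qed

lemma convex_position_across_edge:
  assumes colors: "u \<in> R" "v \<in> R" "b \<in> B" "z \<in> B" "r \<in> R"
    and empty: "R \<inter> open_triangle u v b = {}" and inner: "z \<in> open_triangle u v b"
    and in_wedge: "r \<in> wedge b z v" and nondegenerate: "orient b z v \<noteq> 0"
  shows "convex_position {r, v, b, z}"
proof -
  have "{z, v, b} \<subseteq> convex hull {u, v, b}"
    using inner open_triangle_subset_hull hull_subset[of "{u, v, b}" convex] by blast
  then have "open_triangle z v b \<subseteq> open_triangle u v b"
    unfolding open_triangle_def by (rule interior_convex_hull_mono)
  moreover have "orient z v b \<noteq> 0"
    using nondegenerate by (simp add: orient_rotate)
  ultimately obtain d where "d \<in> open_segment b r" "d \<in> open_segment z v"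
    using wedge_crosses_edge[of z v b r] colors empty in_wedge by blast
  moreover have "r \<noteq> v"
    using wedge_vertex_notin[OF nondegenerate] in_wedge by blast
  moreover have "b \<noteq> z" "{r, v} \<inter> {b, z} = {}"
    using colors nondegenerate colors_disjoint by auto
  ultimately have "convex_position {b, z, r, v}"
    using colors by (intro convex_position_crossing_segments[of d] orient_neq_0) auto
  then show ?thesis
    by (simp add: insert_commute)
qed

lemma hole_of_red_in_inner_wedge:
  assumes "u \<in> R" "v \<in> R" "b \<in> B" "orient u v b \<noteq> 0"
    and single: "B \<inter> open_triangle u v b = {z}" and "R \<inter> open_triangle u v b = {}"
    and wedge: "R \<inter> wedge b z v \<noteq> {}"
  shows "\<exists>Q. balanced_convex_4hole R B Q"
proof -
  have z_inner: "z \<in> B" "z \<in> open_triangle u v b"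
    using single by auto
  have "b \<noteq> z" "v \<noteq> b" "v \<noteq> z"
    using z_inner assms(2-4) triangle_vertex_notin_open_triangle[of u v b b] colors_disjoint by auto
  then have nondegenerate: "orient b z v \<noteq> 0"
    using z_inner(1) assms(2,3) by (intro orient_neq_0) auto
  have inner_wedge: "wedge b z v \<subseteq> wedge b u v"
    using open_triangle_subset_wedge[of b u v] z_inner(2) assms(4)
    by (intro wedge_subset_wedge) (auto simp: orient_rotate)
  let ?Y = "R \<inter> wedge b z v"
  have position: "convex_position {r, v, b, z}" if "r \<in> ?Y" for r
    using that assms z_inner nondegenerate by (intro convex_position_across_edge[of u]) auto
  have "r \<notin> interior (convex hull insert r {v, b, z})" if "r \<in> ?Y" for r
    using convex_position_notin_interior[OF _ position[OF that]] by simp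
  then obtain r where r_minimal: "r \<in> ?Y" "?Y \<inter> interior (convex hull {r, v, b, z}) = {}"
    using minimal_hull_vertex[of ?Y "{v, b, z}"] finite_red wedge by blast
  have in_wedge: "interior (convex hull {r, v, b, z}) \<subseteq> wedge b z v"
    using interior_convex_hull_subset_wedge[OF nondegenerate, of r] r_minimal(1)
    by (simp add: insert_commute)
  have "B \<inter> wedge b z v \<subseteq> {z}"
    using blue_in_wedge_imp_in_triangle[of u v b] assms(1-4) inner_wedge single by blast
  moreover have "z \<notin> wedge b z v"
    using wedge_vertex_notin[OF nondegenerate] by blast
  ultimately have "(R \<union> B) \<inter> interior (convex hull {r, v, b, z}) = {}"
    using in_wedge r_minimal(2) by blast
  moreover have "r \<noteq> v"
    using wedge_vertex_notin[OF nondegenerate] r_minimal(1) by blast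
  ultimately show ?thesis
    using balanced_convex_4holeI[of r v b z] position[OF r_minimal(1)] r_minimal(1) assms(2,3)
      z_inner(1) \<open>b \<noteq> z\<close> by blast
qed

lemma hole_of_single_inner_point:
  assumes "u \<in> R" "v \<in> R" "u \<noteq> v" "b \<in> B"
    and single: "B \<inter> open_triangle u v b = {z}" and empty: "R \<inter> open_triangle u v b = {}"
    and red_in_wedge: "r \<in> R" "r \<in> wedge b u v"
  shows "\<exists>Q. balanced_convex_4hole R B Q"
proof -
  have z_inner: "z \<in> B" "z \<in> open_triangle u v b"
    using single by auto
  have nondegenerate: "orient u v b \<noteq> 0" "orient v u b \<noteq> 0"
    using orient_red_red_blue_neq_0 assms(1-4) by simp_all
  then have "orient b u v \<noteq> 0"
    by (metis orient_rotate)
  have "z \<noteq> b"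
    using z_inner(2) triangle_vertex_notin_open_triangle nondegenerate(1) by blast
  then have "orient b z r \<noteq> 0"
    using assms(4) z_inner(1) red_in_wedge(1) colors_disjoint by (intro orient_neq_0) auto
  moreover have "z \<in> wedge b u v"
    using z_inner(2) open_triangle_subset_wedge[OF \<open>orient b u v \<noteq> 0\<close>] by blast
  ultimately consider (right) "r \<in> wedge b z v" | (left) "r \<in> wedge b z u"
    using wedge_split[OF \<open>orient b u v \<noteq> 0\<close>] red_in_wedge(2) by blast
  then show ?thesis
  proof cases
    case right
    then show ?thesis
      using hole_of_red_in_inner_wedge[OF assms(1,2,4) nondegenerate(1) single empty]
        red_in_wedge(1) by blast
  next
    case left
    have "B \<inter> open_triangle v u b = {z}" "R \<inter> open_triangle v u b = {}"
      using single empty by (simp_all add: open_triangle_commute)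
    with left show ?thesis
      using hole_of_red_in_inner_wedge[OF assms(2,1,4) nondegenerate(2)] red_in_wedge(1) by blast
  qed
qed

lemma cond_C2_one_imp_hole:
  assumes "cond_C2_one R B"
  shows "\<exists>Q. balanced_convex_4hole R B Q"
proof -
  obtain u v b0 where uv: "u \<in> R" "v \<in> R" "u \<noteq> v" and "C2_apex R B u v b0"
    using assms by (auto simp: cond_C2_one_iff hull_edge_def)
  then obtain b where "C2_apex R B u v b"
    and antichain: "\<And>z. z \<in> B \<inter> open_triangle u v b \<Longrightarrow> B \<inter> open_triangle u v z = {}"
    using minimal_C2_apex by blast
  then obtain z r where "b \<in> B" and empty: "R \<inter> open_triangle u v b = {}"
    and z_inner: "z \<in> B \<inter> open_triangle u v b" and red_in_wedge: "r \<in> R" "r \<in> wedge b u v"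
    by (auto simp: C2_apex_def)
  show ?thesis
  proof (cases "B \<inter> open_triangle u v b = {z}")
    case True
    then show ?thesis
      using hole_of_single_inner_point[OF uv \<open>b \<in> B\<close> _ empty red_in_wedge] by blast
  next
    case False
    then obtain z' where "z' \<in> B \<inter> open_triangle u v b" "z' \<noteq> z"
      using z_inner by blast
    moreover have "orient u v b \<noteq> 0"
      using orient_red_red_blue_neq_0 uv \<open>b \<in> B\<close> by blast
    ultimately show ?thesis
      using hole_of_two_inner_points uv(1,2) empty antichain z_inner by blast
  qed
qed

end

lemma (in bicolored_points) C1_or_C2_imp_hole:
  assumes "cond_C1 R B \<or> cond_C2 R B"
  shows "\<exists>Q. balanced_convex_4hole R B Q"
proof -
  consider (C1) "cond_C1 R B" | (C2_red) "cond_C2_one R B" | (C2_blue) "cond_C2_one B R"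
    using assms by (auto simp: cond_C2_def)
  then show ?thesis
  proof cases
    case C1
    then show ?thesis
      by (auto simp: cond_C1_def see_each_other_def)
  next
    case C2_red
    then show ?thesis
      by (rule cond_C2_one_imp_hole)
  next
    case C2_blue
    then show ?thesis
      using swap.cond_C2_one_imp_hole balanced_convex_4hole_commute by blast
  qed
qed

section \<open>Hull edges crossed by a segment\<close>

lemma segment_exit_supporting_hyperplane:
  fixes C :: "'a::euclidean_space set"
  assumes "compact C" "convex C" "m \<in> C" "n \<notin> C"
  obtains p a where "p \<in> C" "p \<in> closed_segment m n" "a \<noteq> 0"
    "\<forall>x\<in>C. a \<bullet> x \<le> a \<bullet> p" "a \<bullet> p \<le> a \<bullet> n"
proof -
  let ?K = "C \<inter> closed_segment m n"
  have "closed ?K" "?K \<noteq> {}"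
    using assms(1,3) by (auto intro: compact_imp_closed compact_Int)
  then obtain p where "p \<in> ?K" and closest: "\<And>q. q \<in> ?K \<Longrightarrow> dist n p \<le> dist n q"
    using distance_attains_inf[of ?K n] by blast
  then have p_exit: "p \<in> C" "p \<in> closed_segment m n" "p \<noteq> n"
    using assms(4) by auto
  have "q \<notin> C" if q_between: "q \<in> open_segment p n" for q
  proof
    assume "q \<in> C"
    moreover have "open_segment p n \<subseteq> closed_segment m n"
      using p_exit(2) segment_open_subset_closed subset_closed_segment ends_in_segment(2) by blast
    ultimately have "dist n p \<le> dist n q"
      using closest q_between by blast
    then show False
      using dist_in_open_segment[OF q_between] by (simp add: dist_commute)
  qed
  then have "C \<inter> open_segment p n = {}"
    by blast
  moreover have "C \<noteq> {}" "open_segment p n \<noteq> {}"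
    using p_exit by auto
  ultimately obtain a \<beta> where separation: "a \<noteq> 0" "\<And>x. x \<in> C \<Longrightarrow> a \<bullet> x \<le> \<beta>"
      "\<And>x. x \<in> open_segment p n \<Longrightarrow> \<beta> \<le> a \<bullet> x"
    using separating_hyperplane_sets[OF assms(2) convex_open_segment, of p n] by blast
  then have "closure (open_segment p n) \<subseteq> {x. \<beta> \<le> a \<bullet> x}"
    by (intro closure_minimal closed_halfspace_ge) auto
  then have "\<beta> \<le> a \<bullet> p" "\<beta> \<le> a \<bullet> n"
    using p_exit(3) by auto
  moreover have "a \<bullet> p \<le> \<beta>"
    using separation(2) p_exit(1) by blast
  ultimately have "\<forall>x\<in>C. a \<bullet> x \<le> a \<bullet> p" "a \<bullet> p \<le> a \<bullet> n"
    using separation(2) by force+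
  then show thesis
    by (rule that[OF p_exit(1,2) separation(1)])
qed

lemma supporting_line_hull_edge:
  assumes "finite X" "general_position X" "p \<in> convex hull X" "p \<notin> X"
    and "a \<noteq> 0" "\<forall>x\<in>convex hull X. a \<bullet> x \<le> a \<bullet> p"
  obtains u v k where "hull_edge X u v" "p \<in> open_segment u v" "0 < k" "a = k *\<^sub>R normal u v"
proof -
  let ?F = "convex hull X \<inter> {x. a \<bullet> x = a \<bullet> p}"
  have face: "?F face_of convex hull X"
    using assms(6) by (intro face_of_Int_supporting_hyperplane_le convex_convex_hull) blast
  then obtain T where face_vertices: "T \<subseteq> X" "?F = convex hull T"
    by (rule face_of_convex_hull_subset[OF finite_imp_compact[OF assms(1)]])
  have on_line: "a \<bullet> x = a \<bullet> p" if "x \<in> T" for x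
    using that face_vertices(2) hull_subset[of T convex] by blast
  have "p \<in> convex hull T"
    using assms(3) face_vertices(2) by blast
  moreover have "p \<notin> T"
    using assms(4) face_vertices(1) by blast
  ultimately obtain u' v' where two_points: "u' \<in> T" "v' \<in> T" "u' \<noteq> v'"
    by (rule convex_hull_two_points)
  then have "a \<bullet> u' = a \<bullet> v'" "u' \<noteq> v'"
    using on_line by auto
  then obtain k where "0 < k" "a = k *\<^sub>R normal u' v' \<or> a = k *\<^sub>R normal v' u'"
    by (rule orthogonal_imp_positive_multiple_of_normal[OF assms(5)])
  then obtain u v where uv: "u \<in> T" "v \<in> T" "u \<noteq> v" and a_eq: "a = k *\<^sub>R normal u v"
    using two_points by metis
  have "x \<in> {u, v}" if "x \<in> T" for x
  proof (rule ccontr)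
    assume "x \<notin> {u, v}"
    moreover have "orient u v x = 0"
      using on_line[OF that] on_line[OF uv(1)] a_eq \<open>0 < k\<close> by (simp add: orient_eq_inner_normal)
    ultimately show False
      using general_position_orient[OF assms(2), of u v x] face_vertices(1) uv that by auto
  qed
  then have "T = {u, v}"
    using uv by blast
  then have "?F = closed_segment u v"
    by (simp only: face_vertices(2) segment_convex_hull)
  then have "hull_edge X u v" "p \<in> closed_segment u v"
    using face uv face_vertices(1) assms(3) by (auto simp: hull_edge_def)
  moreover from this have "p \<in> open_segment u v"
    using assms(4) by (auto simp: open_segment_def hull_edge_def)
  ultimately show thesis
    using that a_eq \<open>0 < k\<close> by blast
qed

lemma hull_edge_commute: "hull_edge X u v \<longleftrightarrow> hull_edge X v u"
  by (auto simp: hull_edge_def closed_segment_commute)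

lemma hull_edge_segment_subset: "hull_edge X u v \<Longrightarrow> closed_segment u v \<subseteq> convex hull X"
  by (simp add: hull_edge_def face_of_imp_subset)

lemma segment_exit_hull_edge:
  assumes "finite X" "general_position X" "m \<in> convex hull X" "n \<notin> convex hull X"
    and free: "closed_segment m n \<inter> X = {}"
  obtains u v p where "hull_edge X u v" "\<forall>x\<in>X. orient u v x \<le> 0" "0 < orient u v n"
    "p \<in> open_segment u v" "p \<in> closed_segment m n"
proof -
  obtain p a where p_exit: "p \<in> convex hull X" "p \<in> closed_segment m n" "a \<noteq> 0"
    and below: "\<forall>x\<in>convex hull X. a \<bullet> x \<le> a \<bullet> p" and above: "a \<bullet> p \<le> a \<bullet> n"
    by (rule segment_exit_supporting_hyperplane[OF finite_imp_compact_convex_hull[OF assms(1)]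
          convex_convex_hull assms(3,4)])
  have "p \<notin> X"
    using p_exit(2) free by blast
  then obtain u v k where edge: "hull_edge X u v" "p \<in> open_segment u v"
    and a_eq: "0 < k" "a = k *\<^sub>R normal u v"
    by (rule supporting_line_hull_edge[OF assms(1,2) p_exit(1) _ p_exit(3) below])
  have "orient u v p = 0"
    using edge(2) open_closed_segment orient_eq_0_closed_segment by blast
  then have shift: "a \<bullet> x - a \<bullet> p = k * orient u v x" for x
    by (simp add: a_eq(2) orient_eq_inner_normal algebra_simps)
  have "orient u v x \<le> 0" if "x \<in> X" for x
    using bspec[OF below hull_inc[OF that]] shift[of x] a_eq(1) mult_pos_pos[of k "orient u v x"]
    by linarith
  moreover have "\<not> collinear {u, v, n}"
  proof
    assume "collinear {u, v, n}"
    moreover have "u \<in> X" "v \<in> X" "n \<notin> closed_segment u v"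
      using edge(1) assms(4) hull_edge_segment_subset[OF edge(1)] by (auto simp: hull_edge_def)
    moreover have "open_segment p n \<subseteq> closed_segment m n"
      using p_exit(2) segment_open_subset_closed subset_closed_segment ends_in_segment(2) by blast
    ultimately show False
      using collinear_beyond_endpoint[OF _ edge(2)] free by blast
  qed
  then have "orient u v n \<noteq> 0"
    by (simp add: collinear_iff_orient)
  moreover have "0 \<le> k * orient u v n"
    using above shift[of n] by linarith
  then have "0 \<le> orient u v n"
    using a_eq(1) by (simp add: zero_le_mult_iff)
  ultimately show thesis
    using that[OF edge(1) _ _ edge(2) p_exit(2)] by simp
qed

section \<open>Balanced holes as crossing quadrilaterals\<close>

text \<open>The vertices are r1, r2, b2, b1 in cyclic order, so that r1 b1 and r2 b2 are sides.\<close>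

definition crossing_quadrilateral ::
    "point set \<Rightarrow> point set \<Rightarrow> point \<Rightarrow> point \<Rightarrow> point \<Rightarrow> point \<Rightarrow> bool" where
  "crossing_quadrilateral R B r1 r2 b1 b2 \<longleftrightarrow>
     r1 \<in> R \<and> r2 \<in> R \<and> r1 \<noteq> r2 \<and> b1 \<in> B \<and> b2 \<in> B \<and> b1 \<noteq> b2 \<and>
     open_segment r1 b2 \<inter> open_segment r2 b1 \<noteq> {}"

lemma crossing_quadrilateral_commute:
  "crossing_quadrilateral R B r1 r2 b1 b2 \<longleftrightarrow> crossing_quadrilateral R B r2 r1 b2 b1"
  by (auto simp: crossing_quadrilateral_def)

lemma crossing_quadrilateral_swap:
  "crossing_quadrilateral R B r1 r2 b1 b2 \<longleftrightarrow> crossing_quadrilateral B R b1 b2 r1 r2"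
  by (auto simp: crossing_quadrilateral_def open_segment_commute)

lemma (in bicolored_points) Radon_part_not_red:
  assumes "balanced_convex_4hole R B Q"
    and "X \<inter> Y = {}" "X \<union> Y = Q" "convex hull X \<inter> convex hull Y \<noteq> {}"
  shows "\<not> X \<subseteq> R"
proof
  assume "X \<subseteq> R"
  have hole: "Q \<subseteq> R \<union> B" "card (Q \<inter> R) = 2" "convex_position Q"
    using assms(1) by (auto simp: balanced_convex_4hole_def)
  have "convex hull X \<inter> convex hull B = {}"
    using hull_mono[OF \<open>X \<subseteq> R\<close>, of convex] hulls_disjoint by blast
  then have "\<not> Y \<subseteq> B"
    using assms(4) hull_mono[of Y B convex] by blast
  then obtain r where red_in_Y: "r \<in> Y" "r \<in> R"
    using assms(3) hole(1) by blast
  have "X \<subset> Q \<inter> R"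
    using assms(2,3) red_in_Y \<open>X \<subseteq> R\<close> by blast
  then have "card X < 2"
    using hole(2) psubset_card_mono[of "Q \<inter> R" X] card.infinite[of "Q \<inter> R"] by fastforce
  moreover have "finite X" "X \<noteq> {}"
    using \<open>X \<subseteq> R\<close> finite_red finite_subset assms(4) by auto
  ultimately have "card X = 1"
    by (simp add: less_2_cases_iff)
  then obtain x where "X = {x}"
    by (auto simp: card_1_singleton_iff)
  moreover from this have "Y = Q - {x}"
    using assms(2,3) by blast
  ultimately have "x \<in> Q" "x \<in> convex hull (Q - {x})"
    using assms(3,4) by auto
  then show False
    using hole(3) by (auto simp: convex_position_def)
qed

context bicolored_points
begin

lemma balanced_hole_Radon_partition:
  assumes hole: "balanced_convex_4hole R B Q"
  obtains M P where "M \<inter> P = {}" "M \<union> P = Q" "convex hull M \<inter> convex hull P \<noteq> {}"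
    "M \<inter> R \<noteq> {}" "P \<inter> R \<noteq> {}" "M \<inter> B \<noteq> {}" "P \<inter> B \<noteq> {}"
proof -
  have "Q \<subseteq> R \<union> B" "card Q = 4"
    using hole by (auto simp: balanced_convex_4hole_def)
  then have "finite Q"
    using finite_red finite_blue finite_subset by blast
  moreover from this have "affine_dependent Q"
    using \<open>card Q = 4\<close> by (intro affine_dependent_biggerset) auto
  ultimately obtain M P where partition: "M \<inter> P = {}" "M \<union> P = Q"
      "convex hull M \<inter> convex hull P \<noteq> {}"
    using Radon_partition[of Q] by blast
  then have partition_swap: "P \<inter> M = {}" "P \<union> M = Q" "convex hull P \<inter> convex hull M \<noteq> {}"
    by blast+
  have swapped_hole: "balanced_convex_4hole B R Q"
    using hole by (simp only: balanced_convex_4hole_commute)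
  have "\<not> M \<subseteq> R" "\<not> P \<subseteq> R" "\<not> M \<subseteq> B" "\<not> P \<subseteq> B"
    using Radon_part_not_red[OF hole partition] Radon_part_not_red[OF hole partition_swap]
      swap.Radon_part_not_red[OF swapped_hole partition]
      swap.Radon_part_not_red[OF swapped_hole partition_swap]
    by blast+
  moreover have "M \<subseteq> R \<union> B" "P \<subseteq> R \<union> B"
    using partition(2) \<open>Q \<subseteq> R \<union> B\<close> by auto
  ultimately have "M \<inter> R \<noteq> {}" "P \<inter> R \<noteq> {}" "M \<inter> B \<noteq> {}" "P \<inter> B \<noteq> {}"
    by blast+
  then show thesis
    by (rule that[OF partition])
qed

lemma balanced_hole_crossing_quadrilateral:
  assumes hole: "balanced_convex_4hole R B Q"
  obtains r1 r2 b1 b2 where "Q = {r1, r2, b1, b2}" "crossing_quadrilateral R B r1 r2 b1 b2"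
proof -
  obtain M P where partition: "M \<inter> P = {}" "M \<union> P = Q" "convex hull M \<inter> convex hull P \<noteq> {}"
    and bichromatic: "M \<inter> R \<noteq> {}" "P \<inter> R \<noteq> {}" "M \<inter> B \<noteq> {}" "P \<inter> B \<noteq> {}"
    using balanced_hole_Radon_partition[OF hole] .
  obtain r1 b2 where "r1 \<in> M \<inter> R" "b2 \<in> M \<inter> B"
    using bichromatic(1,3) by blast
  moreover obtain r2 b1 where "r2 \<in> P \<inter> R" "b1 \<in> P \<inter> B"
    using bichromatic(2,4) by blast
  ultimately have in_parts: "r1 \<in> M" "b2 \<in> M" "r2 \<in> P" "b1 \<in> P"
    and colors: "r1 \<in> R" "r2 \<in> R" "b1 \<in> B" "b2 \<in> B"
    by blast+
  have distinct: "r1 \<noteq> r2" "b1 \<noteq> b2" "{r1, b2} \<inter> {r2, b1} = {}"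
    using in_parts partition(1) by auto
  have "Q \<subseteq> R \<union> B" and card: "card (Q \<inter> R) = 2" "card (Q \<inter> B) = 2"
    using hole by (auto simp: balanced_convex_4hole_def)
  have "{r1, r2} \<subseteq> Q \<inter> R" "{b1, b2} \<subseteq> Q \<inter> B"
    using in_parts colors partition(2) by auto
  then have "{r1, r2} = Q \<inter> R" "{b1, b2} = Q \<inter> B"
    using card distinct(1,2) finite_red finite_blue card_subset_eq[of "Q \<inter> R" "{r1, r2}"]
      card_subset_eq[of "Q \<inter> B" "{b1, b2}"]
    by simp_all
  then have Q_eq: "Q = {r1, r2, b1, b2}"
    using \<open>Q \<subseteq> R \<union> B\<close> by blast
  then have "M = {r1, b2}" "P = {r2, b1}"
    using partition(1,2) in_parts by blast+
  then obtain d where "d \<in> closed_segment r1 b2" "d \<in> closed_segment r2 b1"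
    using partition(3) by (auto simp: segment_convex_hull)
  then have "d \<in> open_segment r1 b2" "d \<in> open_segment r2 b1"
    using general_position_crossing_segments[OF in_general_position _ distinct(3)] colors by auto
  then show thesis
    using that[OF Q_eq] colors distinct(1,2) by (auto simp: crossing_quadrilateral_def)
qed

lemma crossing_quadrilateral_same_side:
  assumes "crossing_quadrilateral R B r1 r2 b1 b2" "orient u v r1 = 0" "orient u v r2 = 0"
  shows "sgn (orient u v b1) = sgn (orient u v b2)"
proof -
  obtain d where "d \<in> open_segment r1 b2" "d \<in> open_segment r2 b1"
    using assms(1) by (auto simp: crossing_quadrilateral_def)
  then show ?thesis
    using orient_sgn_along_ray[of u v r1 d b2] orient_sgn_along_ray[of u v r2 d b1] assms(2,3)
    by (simp add: open_segment_def)
qed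

lemma midpoints_segment_subset_interior:
  assumes "crossing_quadrilateral R B r1 r2 b1 b2"
  shows "open_segment (midpoint r1 r2) (midpoint b1 b2) \<subseteq> interior (convex hull {r1, r2, b1, b2})"
proof
  let ?n = "midpoint b1 b2"
  fix x
  assume "x \<in> open_segment (midpoint r1 r2) ?n"
  then obtain t where x_eq: "0 < t" "t < 1" "x = (1 - t) *\<^sub>R midpoint r1 r2 + t *\<^sub>R ?n"
    by (auto simp: in_segment)
  have "orient r1 r2 b1 \<noteq> 0"
    using assms orient_red_red_blue_neq_0 by (auto simp: crossing_quadrilateral_def)
  then have "orient r1 r2 ?n \<noteq> 0"
    using crossing_quadrilateral_same_side[OF assms, of r1 r2]
    by (simp add: orient_midpoint sgn_if split: if_splits)
  moreover have "x = ((1 - t) / 2) *\<^sub>R r1 + ((1 - t) / 2) *\<^sub>R r2 + t *\<^sub>R ?n"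
    unfolding x_eq(3) by (simp add: midpoint_def prod_eq_iff field_simps)
  moreover have "0 < (1 - t) / 2" "(1 - t) / 2 + (1 - t) / 2 + t = 1"
    using x_eq(2) by (simp_all add: field_simps)
  ultimately have "x \<in> open_triangle r1 r2 ?n"
    using x_eq(1) open_triangle_iff by blast
  moreover have "?n \<in> convex hull {r1, r2, b1, b2}"
    by (intro midpoints_in_convex_hull hull_inc) auto
  then have "{r1, r2, ?n} \<subseteq> convex hull {r1, r2, b1, b2}"
    using hull_subset[of "{r1, r2, b1, b2}" convex] by auto
  then have "open_triangle r1 r2 ?n \<subseteq> interior (convex hull {r1, r2, b1, b2})"
    unfolding open_triangle_def by (rule interior_convex_hull_mono)
  ultimately show "x \<in> interior (convex hull {r1, r2, b1, b2})"
    by blast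
qed

end

section \<open>Hull edges cutting a balanced hole\<close>

definition joins_sides :: "point \<Rightarrow> point \<Rightarrow> point \<Rightarrow> point \<Rightarrow> point \<Rightarrow> point \<Rightarrow> bool" where
  "joins_sides r1 r2 b1 b2 u v \<longleftrightarrow>
     closed_segment r1 b1 \<inter> closed_segment u v \<noteq> {} \<and> closed_segment r2 b2 \<inter> closed_segment u v \<noteq> {}"

lemma joins_sides_commute: "joins_sides r1 r2 b1 b2 u v \<longleftrightarrow> joins_sides r2 r1 b2 b1 u v"
  by (auto simp: joins_sides_def)

lemma joins_sides_swap: "joins_sides r1 r2 b1 b2 u v \<longleftrightarrow> joins_sides b1 b2 r1 r2 u v"
  by (simp add: joins_sides_def closed_segment_commute)

lemma joins_sides_edge_commute: "joins_sides r1 r2 b1 b2 u v \<longleftrightarrow> joins_sides r1 r2 b1 b2 v u"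
  by (simp add: joins_sides_def closed_segment_commute)

definition blocking_edge :: "point set \<Rightarrow> point \<Rightarrow> point \<Rightarrow> point \<Rightarrow> point \<Rightarrow> point \<Rightarrow> point \<Rightarrow> bool" where
  "blocking_edge R r1 r2 b1 b2 u v \<longleftrightarrow>
     hull_edge R u v \<and> (\<forall>z\<in>R. orient u v z \<le> 0) \<and> 0 < orient u v b1 \<and> 0 < orient u v b2 \<and>
     joins_sides r1 r2 b1 b2 u v"

lemma blocking_edge_empty_triangle:
  assumes "blocking_edge R r1 r2 b1 b2 u v" "b \<in> {b1, b2}"
  shows "R \<inter> open_triangle u v b = {}"
proof -
  have "interior (convex hull {u, v, b}) \<inter> convex hull R = {}"
    using assms by (intro interior_disjoint_opposite_hull[of u v])
      (auto simp: blocking_edge_def hull_edge_def)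
  then show ?thesis
    using hull_subset[of R convex] unfolding open_triangle_def by blast
qed

context bicolored_points
begin

lemma blocking_edge_red_side:
  assumes quad: "crossing_quadrilateral R B r1 r2 b1 b2"
    and edge: "hull_edge R u v" "\<forall>z\<in>R. orient u v z \<le> 0"
    and "orient u v (midpoint r1 r2) = 0" "0 < orient u v (midpoint b1 b2)"
  shows "blocking_edge R r1 r2 b1 b2 u v"
proof -
  have quad_red: "r1 \<in> R" "r2 \<in> R" and edge_red: "u \<in> R" "v \<in> R" "u \<noteq> v"
    using quad edge(1) by (auto simp: crossing_quadrilateral_def hull_edge_def)
  have "orient u v r1 \<le> 0" "orient u v r2 \<le> 0" "orient u v r1 + orient u v r2 = 0"
    using assms(4) edge(2) quad_red by (auto simp: orient_midpoint)
  then have on_edge: "orient u v r1 = 0" "orient u v r2 = 0"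
    by linarith+
  then have "r1 \<in> {u, v}" "r2 \<in> {u, v}"
    using orient_neq_0[of u v r1] orient_neq_0[of u v r2] edge_red quad_red by auto
  then have "joins_sides r1 r2 b1 b2 u v"
    unfolding joins_sides_def using ends_in_segment by blast
  moreover have "sgn (orient u v b1) = sgn (orient u v b2)" "0 < orient u v b1 + orient u v b2"
    using crossing_quadrilateral_same_side[OF quad on_edge] assms(5) by (auto simp: orient_midpoint)
  then have "0 < orient u v b1" "0 < orient u v b2"
    by (auto simp: sgn_if split: if_splits)
  ultimately show ?thesis
    using edge by (simp add: blocking_edge_def)
qed

lemma blocking_edge_through_interior:
  assumes quad: "crossing_quadrilateral R B r1 r2 b1 b2"
    and empty: "R \<inter> interior (convex hull {r1, r2, b1, b2}) = {}"
    and edge: "hull_edge R u v" "\<forall>z\<in>R. orient u v z \<le> 0" "0 < orient u v (midpoint b1 b2)"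
    and p_inner: "p \<in> open_segment u v" "p \<in> interior (convex hull {r1, r2, b1, b2})"
  shows "blocking_edge R r1 r2 b1 b2 u v"
proof -
  let ?H = "convex hull {r1, r2, b1, b2}"
  have quad_colors: "r1 \<in> R" "r2 \<in> R" "b1 \<in> B" "b2 \<in> B" and edge_red: "u \<in> R" "v \<in> R"
    using quad edge(1) by (auto simp: crossing_quadrilateral_def hull_edge_def)
  have sign_change: "closed_segment x y \<inter> closed_segment u v \<noteq> {}"
    if corners: "{x, y} \<subseteq> {r1, r2, b1, b2}" and signs: "orient u v x \<le> 0" "0 \<le> orient u v y" for x y
  proof -
    obtain q where q_on_line: "q \<in> closed_segment x y" "orient u v q = 0"
      using orient_sign_change signs by blast
    have "closed_segment x y \<subseteq> ?H"
      unfolding segment_convex_hull by (rule hull_mono[OF corners])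
    then have "q \<in> closed_segment u v"
      using line_meets_convex_in_segment[OF convex_convex_hull p_inner(2) _ _ p_inner(1), of q]
        q_on_line edge_red empty
      by (auto simp: collinear_iff_orient)
    then show ?thesis
      using q_on_line(1) by blast
  qed
  have "0 < orient u v b" if "{b, b'} = {b1, b2}" for b b'
  proof (rule ccontr)
    assume "\<not> 0 < orient u v b"
    moreover have "orient u v b + orient u v b' = orient u v b1 + orient u v b2"
      using that by (auto simp: doubleton_eq_iff)
    ultimately have "orient u v b \<le> 0" "0 \<le> orient u v b'"
      using edge(3) by (auto simp: orient_midpoint)
    then have "closed_segment b b' \<inter> closed_segment u v \<noteq> {}"
      using that by (intro sign_change) auto
    then show False
      using red_blue_segments_disjoint[of u v b b'] that edge_red quad_colors by auto
  qed
  then have above: "0 < orient u v b1" "0 < orient u v b2"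
    by blast+
  then have "joins_sides r1 r2 b1 b2 u v"
    unfolding joins_sides_def using edge(2) quad_colors(1,2) by (intro conjI sign_change) auto
  then show ?thesis
    using edge above by (simp add: blocking_edge_def)
qed

lemma exists_blocking_edge:
  assumes quad: "crossing_quadrilateral R B r1 r2 b1 b2"
    and empty: "R \<inter> interior (convex hull {r1, r2, b1, b2}) = {}"
  obtains u v where "blocking_edge R r1 r2 b1 b2 u v"
proof -
  let ?m = "midpoint r1 r2" and ?n = "midpoint b1 b2"
  have quad_colors: "r1 \<in> R" "r2 \<in> R" "r1 \<noteq> r2" "b1 \<in> B" "b2 \<in> B"
    using quad by (auto simp: crossing_quadrilateral_def)
  have red_midpoint: "?m \<in> convex hull R" and "?n \<in> convex hull B"
    using quad_colors by (auto intro: midpoints_in_convex_hull hull_inc)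
  then have blue_midpoint: "?n \<notin> convex hull R"
    using hulls_disjoint by blast
  have "?m \<notin> R"
    using general_position_closed_segment[OF in_general_position, of r1 r2 ?m] quad_colors(1-3) by auto
  then have "closed_segment ?m ?n \<inter> R = {}"
    using midpoints_segment_subset_interior[OF quad] empty blue_midpoint hull_subset[of R convex]
    by (fastforce simp: closed_segment_eq_open)
  moreover have "general_position R"
    using in_general_position by (auto simp: general_position_def)
  ultimately obtain u v p where edge: "hull_edge R u v" "\<forall>z\<in>R. orient u v z \<le> 0" "0 < orient u v ?n"
    and p_on_edge: "p \<in> open_segment u v" "p \<in> closed_segment ?m ?n"
    using segment_exit_hull_edge[OF finite_red _ red_midpoint blue_midpoint] by blast
  have zero: "orient u v p = 0"
    using p_on_edge(1) open_closed_segment orient_eq_0_closed_segment by blast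
  have "blocking_edge R r1 r2 b1 b2 u v"
  proof (cases "p = ?m")
    case True
    then show ?thesis
      using blocking_edge_red_side[OF quad edge(1,2) _ edge(3)] zero by simp
  next
    case False
    moreover have "p \<noteq> ?n"
      using zero edge(3) by auto
    ultimately have "p \<in> interior (convex hull {r1, r2, b1, b2})"
      using p_on_edge(2) midpoints_segment_subset_interior[OF quad] by (auto simp: open_segment_def)
    then show ?thesis
      using blocking_edge_through_interior[OF quad empty edge p_on_edge(1)] by blast
  qed
  then show thesis
    by (rule that)
qed

end

section \<open>A balanced hole yields C1 or C2\<close>

context bicolored_points
begin

lemma edge_end_in_open_triangle:
  assumes "{r, u, v} \<subseteq> R" "b \<in> B" "{u', v'} \<subseteq> B" "u' \<noteq> v'" "v \<noteq> r"
    and joins: "closed_segment r b \<inter> closed_segment u v \<noteq> {}"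
      "closed_segment r b \<inter> closed_segment u' v' \<noteq> {}"
    and q_beyond: "v \<in> closed_segment u q" "q \<in> closed_segment u' v'"
  shows "v \<in> open_triangle u' v' r"
proof -
  obtain p where p_crossing: "p \<in> closed_segment r b" "p \<in> closed_segment u v"
    using joins(1) by blast
  obtain q' where q'_crossing: "q' \<in> closed_segment r b" "q' \<in> closed_segment u' v'"
    using joins(2) by blast
  have hulls: "closed_segment u v \<subseteq> convex hull R" "closed_segment u' v' \<subseteq> convex hull B"
    "b \<in> convex hull B"
    using assms(1-3) by (auto intro: hull_inc closed_segment_subset_convex_hull[THEN subsetD])
  let ?T = "convex hull {u', v', r}"
  have "closed_segment u' v' \<subseteq> ?T" "r \<in> ?T"
    by (auto simp: segment_convex_hull intro: hull_inc hull_mono[THEN subsetD, rotated])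
  moreover have "p \<in> closed_segment r q'"
    using red_precedes_blue_on_segment[of b p r q'] p_crossing q'_crossing hulls by blast
  ultimately have "p \<in> ?T" "q \<in> ?T"
    using q_beyond(2) q'_crossing(2) closed_segment_subset_convex_hull[of r "{u', v', r}" q'] by blast+
  moreover have "v \<in> closed_segment p q"
    using closed_segment_exchange p_crossing(2) q_beyond(1) by blast
  ultimately have "v \<in> ?T"
    using closed_segment_subset_convex_hull by blast
  moreover have "orient u' v' r \<noteq> 0"
    using swap.orient_red_red_blue_neq_0 assms(1,3,4) by auto
  moreover have "v \<notin> {u', v', r}"
    using assms(1,3,5) colors_disjoint by auto
  ultimately show ?thesis
    using assms(1,3) by (intro general_position_open_triangle[OF in_general_position]) auto
qed

lemma blue_beyond_edge_in_wedge:
  assumes "r \<in> R" "{b, u', v'} \<subseteq> B" "b \<notin> {u', v'}"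
    and "closed_segment r b \<inter> closed_segment u' v' \<noteq> {}"
  shows "b \<in> wedge r u' v'"
proof -
  obtain q where "q \<in> closed_segment r b" "q \<in> closed_segment u' v'"
    using assms(4) by blast
  moreover have "{r, b} \<inter> {u', v'} = {}"
    using assms(1-3) colors_disjoint by auto
  ultimately have "q \<in> open_segment r b" "q \<in> open_segment u' v'"
    using general_position_crossing_segments[OF in_general_position, of r b u' v' q] assms(1,2) by auto
  then show ?thesis
    using wedge_ray open_segment_subset_wedge by blast
qed

lemma edge_end_C2_apex:
  assumes quad: "crossing_quadrilateral R B r1 r2 b1 b2"
    and edge: "{u', v'} \<subseteq> B" "u' \<noteq> v'" "B \<inter> open_triangle u' v' r1 = {}" and uv_red: "{u, v} \<subseteq> R"
    and joins: "joins_sides r1 r2 b1 b2 u v" "joins_sides r1 r2 b1 b2 u' v'"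
    and q_beyond: "v \<in> closed_segment u q" "q \<in> closed_segment u' v'"
    and ends: "v \<noteq> r1" "v' \<noteq> b1" "u' \<noteq> b1 \<or> v = r2"
  shows "C2_apex B R u' v' r1"
proof -
  have quad_colors: "r1 \<in> R" "r2 \<in> R" "b1 \<in> B" "b2 \<in> B"
    using quad by (auto simp: crossing_quadrilateral_def)
  have inner: "v \<in> open_triangle u' v' r1"
    using edge_end_in_open_triangle[of r1 u v b1 u' v' q] joins quad_colors uv_red
      edge(1,2) q_beyond ends(1)
    by (simp add: joins_sides_def)
  have "B \<inter> wedge r1 u' v' \<noteq> {}"
  proof (cases "u' = b1")
    case True
    obtain d where d_crossing: "d \<in> open_segment r1 b2" "d \<in> open_segment r2 b1"
      using quad by (auto simp: crossing_quadrilateral_def)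
    have "orient u' v' r1 \<noteq> 0"
      using swap.orient_red_red_blue_neq_0 edge(1,2) quad_colors(1) by auto
    then have "orient r1 u' v' \<noteq> 0"
      by (metis orient_rotate)
    then have "r2 \<in> wedge r1 b1 v'"
      using inner open_triangle_subset_wedge[of r1 b1 v'] ends(3) True by auto
    then have "d \<in> wedge r1 b1 v'"
      using wedge_open_segment_to_side d_crossing(2) by blast
    then have "b2 \<in> wedge r1 u' v'"
      using wedge_ray d_crossing(1) True by blast
    then show ?thesis
      using quad_colors(4) by blast
  next
    case False
    then have "b1 \<in> wedge r1 u' v'"
      using joins(2) quad_colors(1,3) edge(1) ends(2)
      by (intro blue_beyond_edge_in_wedge) (auto simp: joins_sides_def)
    then show ?thesis
      using quad_colors(3) by blast
  qed
  then show ?thesis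
    using edge(3) inner quad_colors(1) uv_red by (auto simp: C2_apex_def)
qed

lemma edge_end_imp_C2:
  assumes quad: "crossing_quadrilateral R B r1 r2 b1 b2"
    and edge: "hull_edge B u' v'" "\<And>r. r \<in> {r1, r2} \<Longrightarrow> B \<inter> open_triangle u' v' r = {}"
    and uv_red: "{u, v} \<subseteq> R"
    and joins: "joins_sides r1 r2 b1 b2 u v" "joins_sides r1 r2 b1 b2 u' v'"
    and q_beyond: "v \<in> closed_segment u q" "q \<in> closed_segment u' v'"
    and v'_not_corner: "v' \<notin> {b1, b2}"
  shows "cond_C2_one B R"
proof -
  have edge_blue: "{u', v'} \<subseteq> B" "u' \<noteq> v'"
    using edge(1) by (auto simp: hull_edge_def)
  have "r1 \<noteq> r2" "b1 \<noteq> b2"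
    using quad by (auto simp: crossing_quadrilateral_def)
  then consider (first) "v \<noteq> r1" "u' \<noteq> b1 \<or> v = r2" | (second) "v \<noteq> r2" "u' \<noteq> b2 \<or> v = r1"
    by blast
  then have "C2_apex B R u' v' r1 \<or> C2_apex B R u' v' r2"
  proof cases
    case first
    then show ?thesis
      using edge_end_C2_apex[OF quad edge_blue edge(2) uv_red joins q_beyond] v'_not_corner by blast
  next
    case second
    then show ?thesis
      using edge_end_C2_apex[OF _ edge_blue edge(2) uv_red _ _ q_beyond, of r2 r1 b2 b1] v'_not_corner
        quad joins crossing_quadrilateral_commute[of R B r1] joins_sides_commute[of r1] by blast
  qed
  then show ?thesis
    unfolding cond_C2_one_iff using edge(1) by blast
qed

lemma blocking_edge_not_beyond:
  assumes quad: "crossing_quadrilateral R B r1 r2 b1 b2"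
    and blocking: "blocking_edge R r1 r2 b1 b2 u v"
    and edge: "hull_edge B u' v'" "joins_sides r1 r2 b1 b2 u' v'"
  shows "0 < orient u v u' \<or> 0 < orient u v v'"
proof (rule ccontr)
  assume beyond: "\<not> (0 < orient u v u' \<or> 0 < orient u v v')"
  have red: "hull_edge R u v" "joins_sides r1 r2 b1 b2 u v" and above: "0 < orient u v b1"
    using blocking by (auto simp: blocking_edge_def)
  obtain p where "p \<in> closed_segment r1 b1" "p \<in> closed_segment u v"
    using red(2) by (auto simp: joins_sides_def)
  then have p_crossing: "p \<in> closed_segment r1 b1" "p \<in> closed_segment u v" "p \<in> convex hull R"
    using hull_edge_segment_subset[OF red(1)] by blast+
  obtain q where "q \<in> closed_segment r1 b1" "q \<in> closed_segment u' v'"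
    using edge(2) by (auto simp: joins_sides_def)
  then have q_crossing: "q \<in> closed_segment r1 b1" "q \<in> closed_segment u' v'" "q \<in> convex hull B"
    using hull_edge_segment_subset[OF edge(1)] by blast+
  have "r1 \<in> convex hull R"
    using quad by (simp add: crossing_quadrilateral_def hull_inc)
  have "q \<in> closed_segment p b1"
    using swap.red_precedes_blue_on_segment[of r1 q b1 p] p_crossing(1,3) q_crossing(1,3)
      \<open>r1 \<in> convex hull R\<close> closed_segment_commute by metis
  moreover have "q \<noteq> p" "orient u v p = 0"
    using p_crossing(2,3) q_crossing(3) hulls_disjoint orient_eq_0_closed_segment by blast+
  ultimately have "0 < orient u v q"
    using orient_sgn_along_ray[of u v p q b1] above by (simp add: sgn_if split: if_splits)
  moreover have "q \<in> convex hull {u', v'}"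
    using q_crossing(2) by (simp add: segment_convex_hull)
  then have "0 \<le> (- 1) * orient u v q"
    by (rule convex_hull_orient_nonneg[rotated]) (use beyond in auto)
  ultimately show False
    by simp
qed

lemma edge_cut_imp_C2:
  assumes quad: "crossing_quadrilateral R B r1 r2 b1 b2"
    and blocking: "blocking_edge R r1 r2 b1 b2 u v"
    and edge: "hull_edge B u' v'" "\<And>r. r \<in> {r1, r2} \<Longrightarrow> B \<inter> open_triangle u' v' r = {}"
      "joins_sides r1 r2 b1 b2 u' v'"
    and cut: "orient u v v' < 0"
  shows "cond_C2_one B R"
proof -
  have edge_red: "{u, v} \<subseteq> R" "u \<noteq> v" and joins: "joins_sides r1 r2 b1 b2 u v"
    using blocking by (auto simp: blocking_edge_def hull_edge_def)
  have "0 < orient u v u'"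
    using blocking_edge_not_beyond[OF quad blocking edge(1,3)] cut by auto
  then obtain q where q_on_line: "q \<in> closed_segment u' v'" "orient u v q = 0"
    using orient_sign_change[of u v v' u'] cut by (auto simp: closed_segment_commute)
  have "q \<notin> closed_segment u v"
    using q_on_line(1) edge(1) red_blue_segments_disjoint[of u v u' v'] edge_red
    by (auto simp: hull_edge_def)
  then consider "v \<in> closed_segment u q" | "u \<in> closed_segment v q"
    using collinear_open_segmentD[of u v q] q_on_line(2) edge_red(2) open_closed_segment
    by (auto simp: collinear_iff_orient)
  moreover have "v' \<notin> {b1, b2}"
    using cut blocking by (auto simp: blocking_edge_def)
  moreover have "{v, u} \<subseteq> R" "joins_sides r1 r2 b1 b2 v u"
    using edge_red(1) joins joins_sides_edge_commute by blast+
  ultimately show ?thesis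
    using edge_end_imp_C2[OF quad edge(1,2) edge_red(1) joins edge(3) _ q_on_line(1)]
      edge_end_imp_C2[OF quad edge(1,2) _ _ edge(3) _ q_on_line(1), of v u]
    by cases blast+
qed

lemma blocking_edges_cut_imp_C2:
  assumes quad: "crossing_quadrilateral R B r1 r2 b1 b2"
    and red: "blocking_edge R r1 r2 b1 b2 u v" and blue: "blocking_edge B b1 b2 r1 r2 u' v'"
    and cut: "orient u v u' < 0 \<or> orient u v v' < 0"
  shows "cond_C2_one B R"
proof -
  have edge: "hull_edge B u' v'" "joins_sides r1 r2 b1 b2 u' v'"
    using blue joins_sides_swap by (auto simp: blocking_edge_def)
  have empty: "B \<inter> open_triangle u' v' r = {}" if "r \<in> {r1, r2}" for r
    using blocking_edge_empty_triangle[OF blue that] .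
  show ?thesis
  proof (cases "orient u v v' < 0")
    case True
    then show ?thesis
      using edge_cut_imp_C2[OF quad red edge(1) empty edge(2)] by blast
  next
    case False
    then have "orient u v u' < 0"
      using cut by blast
    then show ?thesis
      using edge_cut_imp_C2[OF quad red, of v' u'] edge empty
      by (simp add: hull_edge_commute[of B v'] joins_sides_edge_commute[of _ _ _ _ v']
          open_triangle_commute[of v'])
  qed
qed

lemma facing_edges_imp_C1:
  assumes red: "hull_edge R u v" "\<forall>z\<in>R. orient u v z \<le> 0" "0 < orient u v u'" "0 < orient u v v'"
    and blue: "hull_edge B u' v'" "\<forall>z\<in>B. orient u' v' z \<le> 0" "0 < orient u' v' u" "0 < orient u' v' v"
  shows "cond_C1 R B"
proof -
  let ?I = "interior (convex hull {u, v, u', v'})"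
  have colors: "u \<in> R" "v \<in> R" "u \<noteq> v" "u' \<in> B" "v' \<in> B" "u' \<noteq> v'"
    using red(1) blue(1) by (auto simp: hull_edge_def)
  have "?I \<inter> convex hull R = {}"
    using red colors by (intro interior_disjoint_opposite_hull[of u v]) auto
  moreover have "?I \<inter> convex hull B = {}"
    using blue colors by (intro interior_disjoint_opposite_hull[of u' v']) auto
  moreover from calculation have "(R \<union> B) \<inter> ?I = {}"
    using hull_subset[of R convex] hull_subset[of B convex] by blast
  then have "balanced_convex_4hole R B {u, v, u', v'}"
    using colors red(3,4) blue(3,4) by (intro balanced_convex_4holeI convex_position_facing_segments)
  ultimately show ?thesis
    using red(1) blue(1) unfolding cond_C1_def see_each_other_def by blast
qed

end

lemma (in bicolored_points) balanced_hole_imp_C1_or_C2: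
  assumes hole: "balanced_convex_4hole R B Q"
  shows "cond_C1 R B \<or> cond_C2 R B"
proof -
  obtain r1 r2 b1 b2 where Q_eq: "Q = {r1, r2, b1, b2}"
    and quad: "crossing_quadrilateral R B r1 r2 b1 b2"
    using balanced_hole_crossing_quadrilateral[OF hole] .
  have swapped_quad: "crossing_quadrilateral B R b1 b2 r1 r2"
    using quad crossing_quadrilateral_swap by blast
  have "(R \<union> B) \<inter> interior (convex hull {r1, r2, b1, b2}) = {}"
    using hole Q_eq by (simp add: balanced_convex_4hole_def)
  then have empty: "R \<inter> interior (convex hull {r1, r2, b1, b2}) = {}"
    "B \<inter> interior (convex hull {b1, b2, r1, r2}) = {}"
    by (auto simp: insert_commute)
  obtain u v where red_blocking: "blocking_edge R r1 r2 b1 b2 u v"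
    using exists_blocking_edge[OF quad empty(1)] .
  obtain u' v' where blue_blocking: "blocking_edge B b1 b2 r1 r2 u' v'"
    using swap.exists_blocking_edge[OF swapped_quad empty(2)] .
  have "u \<in> R" "v \<in> R" "u \<noteq> v" "u' \<in> B" "v' \<in> B" "u' \<noteq> v'"
    using red_blocking blue_blocking by (auto simp: blocking_edge_def hull_edge_def)
  then have "orient u v u' \<noteq> 0" "orient u v v' \<noteq> 0" "orient u' v' u \<noteq> 0" "orient u' v' v \<noteq> 0"
    using orient_red_red_blue_neq_0 swap.orient_red_red_blue_neq_0 by blast+
  then consider (red_cuts) "orient u v u' < 0 \<or> orient u v v' < 0"
    | (blue_cuts) "orient u' v' u < 0 \<or> orient u' v' v < 0"
    | (facing) "0 < orient u v u'" "0 < orient u v v'" "0 < orient u' v' u" "0 < orient u' v' v"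
    by linarith
  then show ?thesis
  proof cases
    case red_cuts
    then show ?thesis
      using blocking_edges_cut_imp_C2[OF quad red_blocking blue_blocking] by (simp add: cond_C2_def)
  next
    case blue_cuts
    then show ?thesis
      using swap.blocking_edges_cut_imp_C2[OF swapped_quad blue_blocking red_blocking]
      by (simp add: cond_C2_def)
  next
    case facing
    then show ?thesis
      using facing_edges_imp_C1[of u v u' v'] red_blocking blue_blocking
      by (simp add: blocking_edge_def)
  qed
qed

theorem theorem4:
  fixes R B :: "point set"
  assumes "finite R" and "finite B" and "R \<inter> B = {}"
    and "general_position (R \<union> B)"
    and "linearly_separable R B"
  shows "(\<exists>Q. balanced_convex_4hole R B Q) \<longleftrightarrow> cond_C1 R B \<or> cond_C2 R B"
proof -
  interpret bicolored_points R B
    using assms linearly_separable_imp_hulls_disjoint by unfold_locales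
  show ?thesis
    using balanced_hole_imp_C1_or_C2 C1_or_C2_imp_hole by blast
qed

end
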